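(* Let $(W,S)$ be a simply laced Coxeter system, $\mathbb{F}$ a field, and $\mathbf{q}=(q_s\in\mathbb{F}: s\in S)$ such that $\mathcal{H}(\mathbf{q})$ is collapse-free. Then $\mathcal{H}(\mathbf{q})$ has an $\mathbb{F}$-basis \[ B(\mathbf{q}):=\{T_{w_1}\cdots T_{w_k}:(w_1,\ldots,w_k)\in W(\mathbf{q})\}. \]
   Context: A Coxeter system $(W,S)$ has $S$ finite and $W=\langle S: s^2=1,\ (sts\cdots)_{m_{st}}=(tst\cdots)_{m_{st}}\ \forall s\ne t\in S\rangle$, where $(aba\cdots)_m$ denotes the alternating product of $m$ factors starting with $a$. It is simply laced if $m_{st}\in\{2,3\}$ for all $s\neq t$. The Coxeter diagram is the graph on $S$ with an edge between $s\ne t$ whenever $m_{st}\ge3$. The Hecke algebra $\mathcal{H}(\mathbf{q})$ of $(W,S)$ with independent parameters $\mathbf{q}=(q_s\in\mathbb{F}:s\in S)$ is the unital associative $\mathbb{F}$-algebra generated by $\{T_s:s\in S\}$ subject to $(T_s-1)(T_s+q_s)=0$ for all $s\in S$ and $(T_sT_tT_s\cdots)_{m_{st}}=(T_tT_sT_t\cdots)_{m_{st}}$ for all $s\neq t$ in $S$. For $w\in W$ with a reduced expression $w=st\cdots r$, set $T_w:=T_sT_t\cdots T_r$ (independent of the reduced expression). $\mathcal{H}(\mathbf{q})$ is collapse-free if, whenever $m_{st}$ is odd and $q_s\ne q_t$, at least one of $q_s,q_t$ is $0$. Remove from the Coxeter diagram all edges $\{s,t\}$ with $q_s\neq q_t$,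 and let $S_1,\ldots,S_k$ be the vertex sets of the connected components of the resulting graph. (Thus the elements of each $S_i$ have the same parameter and are connected in the Coxeter diagram, and if $s\in S_i$, $t\in S_j$, $i\neq j$, then either $m_{st}=2$ or exactly one of $q_s,q_t$ is $0$.) Let $W_i:=\langle S_i\rangle$ for $i=1,\ldots,k$. An element $w_i\in W_i$ dominates $S_j$ if $i\neq j$ and there exist $s\in S_i$ and $t\in S_j$ such that $q_s=0$, $m_{st}=3$, and $s$ occurs in some reduced expression of $w_i$. Let $W(\mathbf{q})$ be the set of all $(w_1,\ldots,w_k)\in W_1\times\cdots\times W_k$ such that $w_j=1$ whenever some $w_i$ dominates $S_j$. The asserted basis is understood as a family indexed by $W(\mathbf{q})$. *)

theory Defs
  imports
    "HOL-Library.Extended_Nat"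
    "HOL-Library.Poly_Mapping"
    "HOL-Algebra.Generated_Groups"
    "HOL-Algebra.QuotRing"
    "Jordan_Normal_Form.VS_Connect"
begin

section \<open>Coxeter systems\<close>

definition list_prod :: "('a, 'b) monoid_scheme \<Rightarrow> 'a list \<Rightarrow> 'a" where
  "list_prod G xs = foldr (mult G) xs (one G)"

fun alternating :: "nat \<Rightarrow> 'a \<Rightarrow> 'a \<Rightarrow> 'a list" where
  "alternating 0 s t = []"
| "alternating (Suc n) s t = s # alternating n t s"

text \<open>
  Equality of words over \<open>S\<close> modulo \<open>s\<^sup>2 = 1\<close> and the braid relations. As the generators are
  involutions, every element of the presented group is represented by a positive word, and the
  group presentation coincides with the presentation as a monoid used here. The value
  \<open>m s t = \<infinity>\<close> imposes no relation.
\<close>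

inductive coxeter_equiv :: "'a set \<Rightarrow> ('a \<Rightarrow> 'a \<Rightarrow> enat) \<Rightarrow> 'a list \<Rightarrow> 'a list \<Rightarrow> bool"
  for S :: "'a set" and m :: "'a \<Rightarrow> 'a \<Rightarrow> enat"
where
  refl: "u \<in> lists S \<Longrightarrow> coxeter_equiv S m u u"
| sym: "coxeter_equiv S m u v \<Longrightarrow> coxeter_equiv S m v u"
| trans: "coxeter_equiv S m u v \<Longrightarrow> coxeter_equiv S m v w \<Longrightarrow> coxeter_equiv S m u w"
| square: "u \<in> lists S \<Longrightarrow> v \<in> lists S \<Longrightarrow> s \<in> S \<Longrightarrow>
    coxeter_equiv S m (u @ [s, s] @ v) (u @ v)"
| braid: "u \<in> lists S \<Longrightarrow> v \<in> lists S \<Longrightarrow> s \<in> S \<Longrightarrow> t \<in> S \<Longrightarrow> s \<noteq> t \<Longrightarrow> m s t = enat n \<Longrightarrow>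
    coxeter_equiv S m (u @ alternating n s t @ v) (u @ alternating n t s @ v)"

text \<open>
  The last assumption says that \<open>W\<close> is presented by the Coxeter relations: the kernel of the
  evaluation of words is exactly the congruence generated by them. The diagonal of \<open>m\<close> is not used.
\<close>

locale coxeter_system = group W
  for W :: "('a, 'b) monoid_scheme" (structure) and S :: "'a set" and m :: "'a \<Rightarrow> 'a \<Rightarrow> enat" +
  assumes finite_generators: "finite S"
    and generators_closed: "S \<subseteq> carrier W"
    and matrix_sym: "\<lbrakk>s \<in> S; t \<in> S\<rbrakk> \<Longrightarrow> m s t = m t s"
    and matrix_ge: "\<lbrakk>s \<in> S; t \<in> S; s \<noteq> t\<rbrakk> \<Longrightarrow> 2 \<le> m s t"
    and generated: "generate W S = carrier W"
    and presented: "\<lbrakk>u \<in> lists S; v \<in> lists S\<rbrakk> \<Longrightarrow>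
      list_prod W u = list_prod W v \<longleftrightarrow> coxeter_equiv S m u v"

definition simply_laced :: "'a set \<Rightarrow> ('a \<Rightarrow> 'a \<Rightarrow> enat) \<Rightarrow> bool" where
  "simply_laced S m \<longleftrightarrow> (\<forall>s\<in>S. \<forall>t\<in>S. s \<noteq> t \<longrightarrow> m s t \<in> {2, 3})"

definition coxeter_diagram :: "'a set \<Rightarrow> ('a \<Rightarrow> 'a \<Rightarrow> enat) \<Rightarrow> ('a \<times> 'a) set" where
  "coxeter_diagram S m = {(s, t). s \<in> S \<and> t \<in> S \<and> s \<noteq> t \<and> 3 \<le> m s t}"

definition reduced_expression ::
  "('a, 'b) monoid_scheme \<Rightarrow> 'a set \<Rightarrow> 'a \<Rightarrow> 'a list \<Rightarrow> bool" where
  "reduced_expression W S w u \<longleftrightarrow> u \<in> lists S \<and> list_prod W u = w \<and>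
     (\<forall>v \<in> lists S. list_prod W v = w \<longrightarrow> length u \<le> length v)"


section \<open>Free associative algebras\<close>

datatype 'a free_monoid = Word (letters: "'a list")

text \<open>
  The monoid is written additively because \<^typ>\<open>'a \<Rightarrow>\<^sub>0 'b\<close> carries the convolution product when
  \<^typ>\<open>'a\<close> is of class \<^class>\<open>monoid_add\<close>; the addition is concatenation and not commutative.
\<close>

instantiation free_monoid :: (type) monoid_add
begin

definition "0 = Word []"

definition "u + v = Word (letters u @ letters v)"

instance
  by standard (auto simp: zero_free_monoid_def plus_free_monoid_def)

end

definition monomial :: "'a list \<Rightarrow> 'a free_monoid \<Rightarrow>\<^sub>0 'f::field" where
  "monomial u = Poly_Mapping.single (Word u) 1"

definition scalar :: "'f \<Rightarrow> 'a free_monoid \<Rightarrow>\<^sub>0 'f::field" where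
  "scalar c = Poly_Mapping.single 0 c"

definition free_algebra :: "'a set \<Rightarrow> ('f::field, 'a free_monoid \<Rightarrow>\<^sub>0 'f) module" where
  "free_algebra S =
    \<lparr>carrier = {p. \<forall>u \<in> Poly_Mapping.keys p. letters u \<in> lists S},
     mult = (*), one = 1, zero = 0, add = (+),
     smult = (\<lambda>c p. scalar c * p)\<rparr>"


section \<open>Hecke algebras with independent parameters\<close>

definition hecke_relators ::
  "'a set \<Rightarrow> ('a \<Rightarrow> 'a \<Rightarrow> enat) \<Rightarrow> ('a \<Rightarrow> 'f) \<Rightarrow> ('a free_monoid \<Rightarrow>\<^sub>0 'f::field) set" where
  "hecke_relators S m q =
     {(monomial [s] - 1) * (monomial [s] + scalar (q s)) | s. s \<in> S} \<union>
     {monomial (alternating n s t) - monomial (alternating n t s) | s t n.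
        s \<in> S \<and> t \<in> S \<and> s \<noteq> t \<and> m s t = enat n}"

definition hecke_ideal ::
  "'a set \<Rightarrow> ('a \<Rightarrow> 'a \<Rightarrow> enat) \<Rightarrow> ('a \<Rightarrow> 'f) \<Rightarrow> ('a free_monoid \<Rightarrow>\<^sub>0 'f::field) set" where
  "hecke_ideal S m q = genideal (free_algebra S) (hecke_relators S m q)"

definition hecke_algebra ::
  "'a set \<Rightarrow> ('a \<Rightarrow> 'a \<Rightarrow> enat) \<Rightarrow> ('a \<Rightarrow> 'f::field) \<Rightarrow>
   ('f, ('a free_monoid \<Rightarrow>\<^sub>0 'f) set) module" where
  "hecke_algebra S m q =
    (let A = free_algebra S; I = hecke_ideal S m q; Q = A Quot I
     in \<lparr>carrier = carrier Q, mult = mult Q, one = one Q, zero = zero Q, add = add Q,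
         smult = (\<lambda>c X. \<Union>p\<in>X. I +>\<^bsub>A\<^esub> (c \<odot>\<^bsub>A\<^esub> p))\<rparr>)"

definition hecke_gen ::
  "'a set \<Rightarrow> ('a \<Rightarrow> 'a \<Rightarrow> enat) \<Rightarrow> ('a \<Rightarrow> 'f) \<Rightarrow> 'a \<Rightarrow> ('a free_monoid \<Rightarrow>\<^sub>0 'f::field) set" where
  "hecke_gen S m q s = hecke_ideal S m q +>\<^bsub>free_algebra S\<^esub> monomial [s]"

text \<open>
  The product of generators does not depend on the chosen reduced expression, by Matsumoto's theorem.
\<close>

definition hecke_T ::
  "('a, 'b) monoid_scheme \<Rightarrow> 'a set \<Rightarrow> ('a \<Rightarrow> 'a \<Rightarrow> enat) \<Rightarrow> ('a \<Rightarrow> 'f) \<Rightarrow> 'a \<Rightarrow>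
   ('a free_monoid \<Rightarrow>\<^sub>0 'f::field) set" where
  "hecke_T W S m q w =
     list_prod (hecke_algebra S m q)
       (map (hecke_gen S m q) (SOME u. reduced_expression W S w u))"

definition collapse_free ::
  "'a set \<Rightarrow> ('a \<Rightarrow> 'a \<Rightarrow> enat) \<Rightarrow> ('a \<Rightarrow> 'f::field) \<Rightarrow> bool" where
  "collapse_free S m q \<longleftrightarrow>
     (\<forall>s\<in>S. \<forall>t\<in>S. (\<exists>n. m s t = enat n \<and> odd n) \<and> q s \<noteq> q t \<longrightarrow> q s = 0 \<or> q t = 0)"


section \<open>The index set of the basis\<close>

definition parameter_components ::
  "'a set \<Rightarrow> ('a \<Rightarrow> 'a \<Rightarrow> enat) \<Rightarrow> ('a \<Rightarrow> 'f::field) \<Rightarrow> 'a set set" where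
  "parameter_components S m q =
     (let E = coxeter_diagram S m - {(s, t). q s \<noteq> q t} in (\<lambda>s. E\<^sup>* `` {s}) ` S)"

text \<open>
  In the next two definitions \<open>Ss\<close> enumerates the components \<open>S\<^sub>1, \<dots>, S\<^sub>k\<close> (counted from 0 here).
\<close>

definition dominates ::
  "('a, 'b) monoid_scheme \<Rightarrow> 'a set \<Rightarrow> ('a \<Rightarrow> 'a \<Rightarrow> enat) \<Rightarrow> ('a \<Rightarrow> 'f::field) \<Rightarrow> 'a set list \<Rightarrow>
   nat \<Rightarrow> 'a \<Rightarrow> nat \<Rightarrow> bool" where
  "dominates W S m q Ss i w j \<longleftrightarrow> i \<noteq> j \<and>
     (\<exists>s \<in> Ss ! i. \<exists>t \<in> Ss ! j. q s = 0 \<and> m s t = 3 \<and>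
        (\<exists>u. reduced_expression W S w u \<and> s \<in> set u))"

definition basis_index ::
  "('a, 'b) monoid_scheme \<Rightarrow> 'a set \<Rightarrow> ('a \<Rightarrow> 'a \<Rightarrow> enat) \<Rightarrow> ('a \<Rightarrow> 'f::field) \<Rightarrow> 'a set list \<Rightarrow>
   'a list set" where
  "basis_index W S m q Ss =
     {ws. length ws = length Ss \<and>
          (\<forall>i < length Ss. ws ! i \<in> generate W (Ss ! i)) \<and>
          (\<forall>i < length Ss. \<forall>j < length Ss.
             dominates W S m q Ss i (ws ! i) j \<longrightarrow> ws ! j = one W)}"

definition basis_element ::
  "('a, 'b) monoid_scheme \<Rightarrow> 'a set \<Rightarrow> ('a \<Rightarrow> 'a \<Rightarrow> enat) \<Rightarrow> ('a \<Rightarrow> 'f::field) \<Rightarrow> 'a list \<Rightarrow>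
   ('a free_monoid \<Rightarrow>\<^sub>0 'f) set" where
  "basis_element W S m q ws =
     list_prod (hecke_algebra S m q) (map (hecke_T W S m q) ws)"


section \<open>Well-formedness of the construction\<close>

lemma free_algebra_simps [simp]:
  "carrier (free_algebra S) = {p. \<forall>u \<in> Poly_Mapping.keys p. letters u \<in> lists S}"
  "mult (free_algebra S) = (*)" "one (free_algebra S) = 1" "zero (free_algebra S) = 0"
  "add (free_algebra S) = (+)" "smult (free_algebra S) c p = scalar c * p"
  by (auto simp: free_algebra_def)

lemma free_algebra_mult_closed:
  assumes "p \<in> carrier (free_algebra S)" "r \<in> carrier (free_algebra S)"
  shows "p * r \<in> carrier (free_algebra S)"
  using assms keys_mult[of p r] by (fastforce simp: plus_free_monoid_def)

lemma free_algebra_add_closed: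
  assumes "p \<in> carrier (free_algebra S)" "r \<in> carrier (free_algebra S)"
  shows "p + r \<in> carrier (free_algebra S)"
  using assms keys_add[of p r] by auto

lemma scalar_closed: "scalar c \<in> carrier (free_algebra S)"
  by (simp add: scalar_def zero_free_monoid_def)

lemma one_closed: "1 \<in> carrier (free_algebra S)"
  by (simp add: zero_free_monoid_def)

lemma monomial_closed: "u \<in> lists S \<Longrightarrow> monomial u \<in> carrier (free_algebra S)"
  by (simp add: monomial_def)

lemma uminus_closed: "p \<in> carrier (free_algebra S) \<Longrightarrow> - p \<in> carrier (free_algebra S)"
  by (simp add: Poly_Mapping.in_keys_iff)

lemma scalar_add: "scalar (c + d) = scalar c + scalar d"
  by (simp add: scalar_def single_add)

lemma scalar_mult: "scalar (c * d) = scalar c * scalar d"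
  by (simp add: scalar_def mult_single)

lemma scalar_one: "scalar 1 = 1"
  by (simp add: scalar_def)

lemma ring_free_algebra:
  "ring (free_algebra S :: ('f::field, 'a free_monoid \<Rightarrow>\<^sub>0 'f) module)" (is "ring ?A")
proof (rule ringI)
  show "abelian_group ?A"
  proof (rule abelian_groupI)
    fix p assume "p \<in> carrier ?A"
    then show "\<exists>r \<in> carrier ?A. r \<oplus>\<^bsub>?A\<^esub> p = \<zero>\<^bsub>?A\<^esub>"
      using uminus_closed by (intro bexI[of _ "- p"]) auto
  next
    fix p r assume "p \<in> carrier ?A" "r \<in> carrier ?A"
    then show "p \<oplus>\<^bsub>?A\<^esub> r \<in> carrier ?A"
      using free_algebra_add_closed by (simp only: free_algebra_simps(5))
  qed (auto simp: algebra_simps)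
  show "Group.monoid ?A"
  proof (rule monoidI)
    fix p r assume "p \<in> carrier ?A" "r \<in> carrier ?A"
    then show "p \<otimes>\<^bsub>?A\<^esub> r \<in> carrier ?A"
      using free_algebra_mult_closed by (simp only: free_algebra_simps(2))
  next
    show "\<one>\<^bsub>?A\<^esub> \<in> carrier ?A"
      using one_closed by (simp only: free_algebra_simps(3))
  qed (auto simp: algebra_simps)
qed (auto simp: algebra_simps)

lemma alternating_subset: "x \<in> set (alternating n s t) \<Longrightarrow> x = s \<or> x = t"
  by (induction n arbitrary: s t) auto

lemma hecke_relators_closed: "hecke_relators S m q \<subseteq> carrier (free_algebra S)"
proof -
  have diff: "p - r \<in> carrier (free_algebra S)"
    if "p \<in> carrier (free_algebra S)" "r \<in> carrier (free_algebra S)"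
    for p r :: "'a free_monoid \<Rightarrow>\<^sub>0 'b"
    using free_algebra_add_closed[OF that(1) uminus_closed[OF that(2)]]
    by (simp del: free_algebra_simps)
  show ?thesis
    unfolding hecke_relators_def
    by (auto simp del: free_algebra_simps
        intro!: free_algebra_mult_closed free_algebra_add_closed diff
          scalar_closed one_closed monomial_closed dest: alternating_subset)
qed

lemma ideal_hecke_ideal: "ideal (hecke_ideal S m q) (free_algebra S)"
  unfolding hecke_ideal_def
  by (rule ring.genideal_ideal[OF ring_free_algebra hecke_relators_closed])

lemma ring_hecke_algebra: "ring (hecke_algebra S m q)"
proof -
  interpret Q: ring "free_algebra S Quot hecke_ideal S m q"
    by (rule ideal.quotient_is_ring[OF ideal_hecke_ideal])
  show ?thesis
  proof (rule ringI)
    show "abelian_group (hecke_algebra S m q)"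
      by (rule abelian_groupI)
        (auto simp: hecke_algebra_def Let_def Q.a_ac intro: Q.l_neg Q.a_inv_closed)
    show "Group.monoid (hecke_algebra S m q)"
      by (rule monoidI) (auto simp: hecke_algebra_def Let_def Q.m_assoc)
  qed (auto simp: hecke_algebra_def Let_def Q.l_distr Q.r_distr)
qed

lemma hecke_smult_coset:
  assumes "p \<in> carrier (free_algebra S)"
  shows "c \<odot>\<^bsub>hecke_algebra S m q\<^esub> (hecke_ideal S m q +>\<^bsub>free_algebra S\<^esub> p) =
    hecke_ideal S m q +>\<^bsub>free_algebra S\<^esub> (scalar c * p)"
proof -
  interpret I: ideal "hecke_ideal S m q" "free_algebra S" by (rule ideal_hecke_ideal)
  let ?I = "hecke_ideal S m q" and ?A = "free_algebra S :: ('b, _) module"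
  have "?I +>\<^bsub>?A\<^esub> (scalar c * r) = ?I +>\<^bsub>?A\<^esub> (scalar c * p)" if "r \<in> ?I +>\<^bsub>?A\<^esub> p" for r
  proof -
    from that obtain i where i: "i \<in> ?I" "r = i + p"
      by (auto simp: a_r_coset_def')
    have "scalar c * i \<in> ?I"
      using I.I_l_closed[OF i(1) scalar_closed] by simp
    then have "scalar c * r \<in> ?I +>\<^bsub>?A\<^esub> (scalar c * p)"
      using i(2) by (auto simp: a_r_coset_def' distrib_left)
    then show ?thesis
      using I.a_repr_independence'[OF _ free_algebra_mult_closed[OF scalar_closed assms]] by metis
  qed
  moreover have "p \<in> ?I +>\<^bsub>?A\<^esub> p"
    using I.a_rcos_self assms by blast
  ultimately have "(\<Union>r \<in> ?I +>\<^bsub>?A\<^esub> p. ?I +>\<^bsub>?A\<^esub> (scalar c * r)) = ?I +>\<^bsub>?A\<^esub> (scalar c * p)"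
    by blast
  then show ?thesis
    by (simp only: hecke_algebra_def Let_def module.simps free_algebra_simps)
qed

lemma vectorspace_hecke_algebra:
  fixes q :: "'a \<Rightarrow> 'f::field"
  shows "vectorspace class_ring (hecke_algebra S m q)" (is "vectorspace _ ?H")
proof -
  interpret I: ideal "hecke_ideal S m q" "free_algebra S" by (rule ideal_hecke_ideal)
  interpret H: ring ?H by (rule ring_hecke_algebra)
  let ?A = "free_algebra S :: ('f, 'a free_monoid \<Rightarrow>\<^sub>0 'f) module"
  define \<pi> where "\<pi> p = hecke_ideal S m q +>\<^bsub>?A\<^esub> p" for p
  have carrier: "carrier ?H = \<pi> ` carrier ?A"
    unfolding \<pi>_def
    by (auto simp: hecke_algebra_def Let_def FactRing_def A_RCOSETS_def' simp del: free_algebra_simps)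
  have add: "\<pi> p \<oplus>\<^bsub>?H\<^esub> \<pi> r = \<pi> (p + r)" if "p \<in> carrier ?A" "r \<in> carrier ?A" for p r
    using I.a_rcos_sum[OF that] by (simp add: \<pi>_def hecke_algebra_def Let_def FactRing_def)
  have smult: "c \<odot>\<^bsub>?H\<^esub> \<pi> p = \<pi> (scalar c * p)" if "p \<in> carrier ?A" for c p
    unfolding \<pi>_def by (rule hecke_smult_coset[OF that])
  note closed = free_algebra_mult_closed[OF scalar_closed] free_algebra_add_closed
  have "module class_ring ?H"
  proof (rule moduleI)
    show "cring (class_ring :: 'f ring)" by (rule class_cring.is_cring)
    show "abelian_group ?H" by (rule H.is_abelian_group)
  qed (auto simp: carrier add smult closed scalar_add scalar_mult scalar_one algebra_simps
      simp del: free_algebra_simps)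
  then show ?thesis
    by (intro vectorspace.intro class_field.field_axioms)
qed

end

theory Submission
  imports Defs
begin

text \<open>
  If \<open>q\<^sub>s = 0 \<noteq> q\<^sub>t\<close> and \<open>m\<^sub>s\<^sub>t = 3\<close>, then \<open>T\<^sub>sT\<^sub>t = T\<^sub>tT\<^sub>s = T\<^sub>s\<close>, and \<open>T\<^sub>s\<close> absorbs in the same way every
  generator of the component of \<open>t\<close>. Hence generators of different components commute, the products
  \<open>T\<^sub>w\<^sub>1 \<cdots> T\<^sub>w\<^sub>k\<close> with arbitrary \<open>w\<^sub>i \<in> W\<^sub>i\<close> span the algebra, and a factor whose component is dominated may be dropped.

  For independence, let \<open>A\<close> be a set of generators with parameter 0. The algebra acts on functions on
  \<open>W\<close> as follows: generators outside \<open>A\<close> with parameter 0 act as 0, generators in components dominated by \<open>A\<close> act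
  as the identity, and the others by the transposed regular representation. Evaluation at 1 sends a
  basis element whose letters of parameter 0 are exactly \<open>A\<close> to evaluation at the inverse of \<open>w\<^sub>1 \<cdots> w\<^sub>k\<close>, and kills a
  basis element with a letter of parameter 0 outside \<open>A\<close>. Ordered by the size of \<open>A\<close>, this is a triangular
  system of linear forms.
\<close>

section \<open>Coxeter groups of simply laced type\<close>

text \<open>The obstacle is an edge \<open>m s t = 3\<close> with \<open>q s\<close> different from
  \<open>q t\<close>: there the regular representation violates the braid relation.
  Collapse-freeness gives such an edge one endpoint s of parameter 0 and one endpoint t of nonzero
  parameter, and the relation can be repaired in two ways. T_s = 0 satisfies the quadratic relation
  because q_s = 0, and makes both sides of the braid relation vanish; T_t = 1 always satisfies the
  quadratic relation, and turns the braid relation into T_s T_s = T_s. The set A records which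
  repair is made at each generator of parameter 0. Acting on functions makes evaluation at 1 a
  linear form at once, also when W is infinite. Two facts about W carry the argument. All reduced
  words of an element use the same letters, so domination can be tested on the chosen word; and
  parabolic subgroups with disjoint sets of generators meet trivially, so a tuple is determined by
  its product in W. Both rest on the presentation, through the exchange property and Matsumoto's
  theorem.\<close>

lemma list_prod_Nil [simp]: "list_prod G [] = \<one>\<^bsub>G\<^esub>"
  by (simp add: list_prod_def)

lemma list_prod_Cons [simp]: "list_prod G (x # xs) = x \<otimes>\<^bsub>G\<^esub> list_prod G xs"
  by (simp add: list_prod_def)

lemma alternating_two: "alternating 2 s t = [s, t]"
  by (simp add: numeral_2_eq_2)

lemma alternating_three: "alternating 3 s t = [s, t, s]"
  by (simp add: numeral_3_eq_3)

context monoid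
begin

lemma list_prod_closed [simp, intro]: "xs \<in> lists (carrier G) \<Longrightarrow> list_prod G xs \<in> carrier G"
  by (induction xs) auto

lemma list_prod_append:
  "\<lbrakk>xs \<in> lists (carrier G); ys \<in> lists (carrier G)\<rbrakk> \<Longrightarrow>
    list_prod G (xs @ ys) = list_prod G xs \<otimes> list_prod G ys"
  by (induction xs) (auto simp: m_assoc)

end

locale simply_laced_coxeter = coxeter_system +
  assumes laced: "simply_laced S m"
begin

abbreviation ev :: "'a list \<Rightarrow> 'a" where
  "ev \<equiv> list_prod W"

lemma gen_closed [simp]: "s \<in> S \<Longrightarrow> s \<in> carrier W"
  using generators_closed by blast

lemma lists_gen_closed: "u \<in> lists S \<Longrightarrow> u \<in> lists (carrier W)"
  using generators_closed by auto

lemma ev_closed [simp]: "u \<in> lists S \<Longrightarrow> ev u \<in> carrier W"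
  using lists_gen_closed by blast

lemma rev_in_lists [simp]: "rev u \<in> lists S \<longleftrightarrow> u \<in> lists S"
  by (simp add: in_lists_conv_set)

lemma ev_append: "\<lbrakk>u \<in> lists S; v \<in> lists S\<rbrakk> \<Longrightarrow> ev (u @ v) = ev u \<otimes> ev v"
  by (simp add: list_prod_append lists_gen_closed)

lemma m_cases: "\<lbrakk>s \<in> S; t \<in> S; s \<noteq> t\<rbrakk> \<Longrightarrow> m s t = 2 \<or> m s t = 3"
  using laced by (auto simp: simply_laced_def)

lemma gen_sq [simp]: "s \<in> S \<Longrightarrow> s \<otimes> s = \<one>"
  using presented[of "[s, s]" "[]"] coxeter_equiv.square[of "[]" S "[]" s m] by simp

lemma gen_cancel [simp]: "\<lbrakk>s \<in> S; x \<in> carrier W\<rbrakk> \<Longrightarrow> s \<otimes> (s \<otimes> x) = x"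
  by (simp flip: m_assoc)

lemma inv_gen [simp]: "s \<in> S \<Longrightarrow> inv s = s"
  by (simp add: inv_equality)

lemma braid2:
  assumes "s \<in> S" "t \<in> S" "s \<noteq> t" "m s t = 2"
  shows "s \<otimes> t = t \<otimes> s"
  using presented[of "[s, t]" "[t, s]"] coxeter_equiv.braid[of "[]" S "[]" s t m 2] assms
  by (simp add: alternating_two numeral_eq_enat)

lemma braid3:
  assumes "s \<in> S" "t \<in> S" "s \<noteq> t" "m s t = 3"
  shows "s \<otimes> (t \<otimes> s) = t \<otimes> (s \<otimes> t)"
  using presented[of "[s, t, s]" "[t, s, t]"] coxeter_equiv.braid[of "[]" S "[]" s t m 3] assms
  by (simp add: alternating_three numeral_eq_enat)

lemma ev_rev:
  assumes "u \<in> lists S" shows "ev (rev u) = inv (ev u)"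
  using assms
proof (induction u)
  case (Cons s u)
  then show ?case using ev_append[of "rev u" "[s]"] by (simp add: inv_mult_group)
qed simp

text \<open>Positive words suffice because the generators are involutions.\<close>

lemma generate_words:
  assumes "I \<subseteq> S" shows "generate W I = ev ` lists I"
proof (intro equalityI subsetI)
  fix x assume "x \<in> generate W I"
  then show "x \<in> ev ` lists I"
  proof induction
    case one
    then show ?case by (intro image_eqI[of _ _ "[]"]) auto
  next
    case (incl h)
    then show ?case using assms by (intro image_eqI[of _ _ "[h]"]) auto
  next
    case (inv h)
    then show ?case using assms by (intro image_eqI[of _ _ "[h]"]) auto
  next
    case (eng h1 h2)
    then obtain u v where *: "u \<in> lists I" "h1 = ev u" "v \<in> lists I" "h2 = ev v" by blast
    then have "u \<in> lists S" "v \<in> lists S" using assms by auto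
    then show ?case using * ev_append by (intro image_eqI[of _ _ "u @ v"]) auto
  qed
next
  fix x assume "x \<in> ev ` lists I"
  then obtain u where "u \<in> lists I" "x = ev u" by blast
  moreover have "u \<in> lists I \<Longrightarrow> ev u \<in> generate W I" for u
    by (induction u) (simp_all add: generate.one generate.eng generate.incl)
  ultimately show "x \<in> generate W I" by blast
qed

lemma word_exists: "x \<in> carrier W \<Longrightarrow> \<exists>u \<in> lists S. ev u = x"
  using generate_words[of S] generated by auto


subsection \<open>Reflections and exchange\<close>

text \<open>
  Whether \<open>x\<close> occurs an odd number of times in the sequence of reflections
  \<open>s\<^sub>1 \<cdots> s\<^sub>i \<cdots> s\<^sub>1\<close> of the word \<open>s\<^sub>1 \<cdots> s\<^sub>n\<close>.
\<close>

fun odd_refl :: "'a list \<Rightarrow> 'a \<Rightarrow> bool" where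
  "odd_refl [] x = False"
| "odd_refl (s # u) x = ((x = s) \<noteq> odd_refl u (s \<otimes> (x \<otimes> s)))"

lemma odd_refl_append_cong:
  assumes "\<And>x. x \<in> carrier W \<Longrightarrow> odd_refl v x = odd_refl v' x" "u \<in> lists S" "x \<in> carrier W"
  shows "odd_refl (u @ v) x = odd_refl (u @ v') x"
  using assms(2,3) by (induction u arbitrary: x) (auto simp: assms(1))

text \<open>Both new reflections equal s and cancel modulo 2; conjugating the later ones twice by s
  restores them.\<close>

lemma odd_refl_square:
  assumes "s \<in> S" "x \<in> carrier W"
  shows "odd_refl (s # s # v) x = odd_refl v x"
proof -
  have "x \<otimes> s = \<one> \<longleftrightarrow> x = s"
    using assms by (metis gen_closed gen_sq right_cancel)
  then show ?thesis using assms by (cases "x = s") (auto simp: m_assoc)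
qed

lemma conj_eq_iff:
  assumes "s \<in> S" "x \<in> carrier W" "y \<in> carrier W"
  shows "s \<otimes> (x \<otimes> s) = y \<longleftrightarrow> x = s \<otimes> (y \<otimes> s)"
  using assms by (auto simp: m_assoc)

lemma odd_refl_braid2:
  assumes "s \<in> S" "t \<in> S" "s \<noteq> t" "m s t = 2" "x \<in> carrier W"
  shows "odd_refl (s # t # v) x = odd_refl (t # s # v) x"
proof -
  have c: "s \<otimes> t = t \<otimes> s" using braid2 assms by blast
  have "t \<otimes> (s \<otimes> (x \<otimes> s) \<otimes> t) = s \<otimes> (t \<otimes> (x \<otimes> t) \<otimes> s)"
    using assms c by (simp add: m_assoc) (simp add: c flip: m_assoc)
  moreover have "s \<otimes> (x \<otimes> s) = t \<longleftrightarrow> x = t" "t \<otimes> (x \<otimes> t) = s \<longleftrightarrow> x = s"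
    using assms c by (simp_all add: conj_eq_iff) (simp_all flip: c)
  ultimately show ?thesis by auto
qed

text \<open>The reflections of \<open>sts\<close> are s, sts, t and those of \<open>tst\<close> are
  t, tst, s: the same three elements in opposite order. For the rest of the word, the argument is
  conjugated by the same group element on both sides.\<close>

lemma odd_refl_braid3:
  assumes "s \<in> S" "t \<in> S" "s \<noteq> t" "m s t = 3" "x \<in> carrier W"
  shows "odd_refl (s # t # s # v) x = odd_refl (t # s # t # v) x"
proof -
  have c: "s \<otimes> (t \<otimes> s) = t \<otimes> (s \<otimes> t)" using braid3 assms by blast
  have c': "s \<otimes> (t \<otimes> (s \<otimes> y)) = t \<otimes> (s \<otimes> (t \<otimes> y))" if "y \<in> carrier W" for y
    using c that assms by (metis gen_closed m_assoc m_closed)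
  have "s \<otimes> (t \<otimes> (s \<otimes> (x \<otimes> s) \<otimes> t) \<otimes> s) = t \<otimes> (s \<otimes> (t \<otimes> (x \<otimes> t) \<otimes> s) \<otimes> t)"
    using assms by (simp add: m_assoc c c')
  moreover have "t \<otimes> (s \<otimes> (x \<otimes> s) \<otimes> t) = s \<longleftrightarrow> x = t"
    using assms by (simp add: conj_eq_iff) (simp add: m_assoc c c')
  moreover have "s \<otimes> (t \<otimes> (x \<otimes> t) \<otimes> s) = t \<longleftrightarrow> x = s"
    using assms by (simp add: conj_eq_iff) (simp add: m_assoc c[symmetric] c'[symmetric])
  moreover have "s \<otimes> (x \<otimes> s) = t \<longleftrightarrow> t \<otimes> (x \<otimes> t) = s"
    using assms c by (simp add: conj_eq_iff) (simp add: m_assoc c[symmetric])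
  ultimately show ?thesis by auto
qed

lemma odd_refl_coxeter_equiv:
  "coxeter_equiv S m u v \<Longrightarrow> x \<in> carrier W \<Longrightarrow> odd_refl u x = odd_refl v x"
proof (induction arbitrary: x rule: coxeter_equiv.induct)
  case (square u v s)
  then show ?case using odd_refl_append_cong[of "s # s # v" v u x] odd_refl_square by simp
next
  case (braid u v s t n)
  have "odd_refl (alternating n s t @ v) y = odd_refl (alternating n t s @ v) y"
    if "y \<in> carrier W" for y
    using m_cases[of s t] braid odd_refl_braid2[of s t y v] odd_refl_braid3[of s t y v] that
    by (auto simp: numeral_eq_enat alternating_two alternating_three)
  then show ?case using braid odd_refl_append_cong[of _ _ u x] by blast
qed auto

text \<open>Equality in W is exactly \<open>coxeter_equiv\<close>, and the parity survives each of
  its rules. It therefore belongs to the group element, although it is computed from a word.\<close>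

lemma odd_refl_cong:
  assumes "u \<in> lists S" "v \<in> lists S" "ev u = ev v" "x \<in> carrier W"
  shows "odd_refl u x = odd_refl v x"
  using presented odd_refl_coxeter_equiv assms by blast

text \<open>An odd count is positive, so x is one of the elements s_1...s_i...s_1, and
  multiplication by it deletes s_i. The recursion carries x to such a letter by conjugation.\<close>

lemma strong_exchange:
  assumes "u \<in> lists S" "x \<in> carrier W" "odd_refl u x"
  shows "\<exists>a c b. u = a @ c # b \<and> x \<otimes> ev u = ev (a @ b)"
  using assms
proof (induction u arbitrary: x)
  case (Cons s u)
  then have s: "s \<in> S" "u \<in> lists S" by auto
  show ?case
  proof (cases "x = s")
    case True
    then show ?thesis using s by (intro exI[of _ "[]"] exI[of _ s] exI[of _ u]) simp
  next
    case False
    then obtain a c b where *: "u = a @ c # b" "s \<otimes> (x \<otimes> s) \<otimes> ev u = ev (a @ b)"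
      using Cons.IH[of "s \<otimes> (x \<otimes> s)"] Cons.prems s by (simp only: odd_refl.simps) auto
    have "x \<otimes> ev (s # u) = s \<otimes> (s \<otimes> (x \<otimes> s) \<otimes> ev u)"
      using s Cons.prems by (simp add: m_assoc)
    then show ?thesis using * by (intro exI[of _ "s # a"] exI[of _ c] exI[of _ b]) simp
  qed
qed simp

section \<open>Length, descents and reduced words\<close>

definition len :: "'a \<Rightarrow> nat" where
  "len w = (LEAST n. \<exists>u \<in> lists S. ev u = w \<and> length u = n)"

definition reduced :: "'a list \<Rightarrow> bool" where
  "reduced u \<longleftrightarrow> u \<in> lists S \<and> len (ev u) = length u"

lemma reduced_lists: "reduced u \<Longrightarrow> u \<in> lists S"
  by (simp add: reduced_def)

lemma len_le: "u \<in> lists S \<Longrightarrow> len (ev u) \<le> length u"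
  unfolding len_def by (rule Least_le) auto

lemma reduced_exists:
  assumes "w \<in> carrier W" shows "\<exists>u. reduced u \<and> ev u = w"
proof -
  from word_exists[OF assms] obtain u where "u \<in> lists S" "ev u = w" by blast
  then have "\<exists>u \<in> lists S. ev u = w \<and> length u = len w"
    unfolding len_def by (intro LeastI_ex[where P = "\<lambda>n. \<exists>u \<in> lists S. ev u = w \<and> length u = n"]) auto
  then show ?thesis by (auto simp: reduced_def)
qed

lemma reduced_expression_iff: "reduced_expression W S w u \<longleftrightarrow> reduced u \<and> ev u = w"
proof
  assume *: "reduced_expression W S w u"
  then have "w \<in> carrier W" by (auto simp: reduced_expression_def)
  then obtain v where "reduced v" "ev v = w" using reduced_exists by blast
  then show "reduced u \<and> ev u = w"
    using * len_le[of u] by (auto simp: reduced_expression_def reduced_def intro: antisym)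
next
  assume "reduced u \<and> ev u = w"
  then show "reduced_expression W S w u"
    using len_le unfolding reduced_expression_def reduced_def by metis
qed

lemma len_one [simp]: "len \<one> = 0"
  using len_le[of "[]"] by simp

lemma reduced_Nil [simp]: "reduced []"
  by (simp add: reduced_def)

lemma len_mult_le:
  assumes "s \<in> S" "w \<in> carrier W" shows "len (s \<otimes> w) \<le> Suc (len w)"
proof -
  obtain u where u: "reduced u" "ev u = w" using reduced_exists assms by blast
  then have "len (ev (s # u)) \<le> length (s # u)" using len_le[of "s # u"] assms by (auto simp: reduced_def)
  moreover have "length u = len w" using u by (auto simp: reduced_def)
  ultimately show ?thesis using u by auto
qed

lemma len_down:
  assumes "u \<in> lists S" "s \<in> S" "odd_refl u s"
  shows "len (s \<otimes> ev u) < len (ev u)"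
proof -
  obtain v where v: "reduced v" "ev v = ev u" using reduced_exists[of "ev u"] assms by auto
  then have "odd_refl v s" using assms odd_refl_cong[of u v s] by (simp add: reduced_def)
  then obtain a c b where "v = a @ c # b" "s \<otimes> ev v = ev (a @ b)"
    using strong_exchange[of v s] v assms by (auto simp: reduced_def)
  then show ?thesis using v len_le[of "a @ b"] by (simp add: reduced_def)
qed

text \<open>Prefixing s flips the parity at s, so this is \<open>len_down\<close> for the word
  \<open>s # u\<close>. Together they exclude equal lengths.\<close>

lemma len_up:
  assumes "u \<in> lists S" "s \<in> S" "\<not> odd_refl u s"
  shows "len (ev u) < len (s \<otimes> ev u)"
  using len_down[of "s # u" s] assms by simp

lemma len_cases:
  assumes "s \<in> S" "w \<in> carrier W"
  shows "len (s \<otimes> w) = Suc (len w) \<or> len w = Suc (len (s \<otimes> w))"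
proof -
  obtain u where u: "u \<in> lists S" "ev u = w" using word_exists assms by blast
  have "len (s \<otimes> w) < len w \<or> len w < len (s \<otimes> w)" using len_up len_down u assms by blast
  moreover have "len (s \<otimes> w) \<le> Suc (len w)" "len w \<le> Suc (len (s \<otimes> w))"
    using len_mult_le[of s w] len_mult_le[of s "s \<otimes> w"] assms by simp_all
  ultimately show ?thesis by linarith
qed

lemma exchange:
  assumes "u \<in> lists S" "s \<in> S" "len (s \<otimes> ev u) < len (ev u)"
  shows "\<exists>a c b. u = a @ c # b \<and> s \<otimes> ev u = ev (a @ b)"
  using strong_exchange[of u s] len_up[of u s] assms by fastforce

lemma reduced_Cons:
  assumes "reduced u" "s \<in> S" "len (ev u) < len (s \<otimes> ev u)"
  shows "reduced (s # u)"
  using assms len_cases[of s "ev u"] by (auto simp: reduced_def)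

lemma reduced_tl: "reduced (s # u) \<Longrightarrow> reduced u"
  using len_mult_le[of s "ev u"] len_le[of u] by (auto simp: reduced_def)

lemma reduced_Cons_up: "reduced (s # u) \<Longrightarrow> len (s \<otimes> ev u) = Suc (len (ev u))"
  using reduced_tl[of s u] by (auto simp: reduced_def)

text \<open>Whenever a prefixed letter shortens the element, exchange deletes a letter instead; new
  letters never appear.\<close>

lemma reduced_subword:
  "u \<in> lists S \<Longrightarrow> \<exists>v. reduced v \<and> ev v = ev u \<and> set v \<subseteq> set u"
proof (induction u)
  case Nil
  then show ?case by (intro exI[of _ "[]"]) simp
next
  case (Cons s u)
  then obtain v where v: "reduced v" "ev v = ev u" "set v \<subseteq> set u" by auto
  have s: "s \<in> S" and u: "u \<in> lists S" using Cons by auto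
  show ?case
  proof (cases "len (ev v) < len (s \<otimes> ev v)")
    case True
    then show ?thesis using v reduced_Cons[of v s] s by (intro exI[of _ "s # v"]) auto
  next
    case False
    then have l: "len (ev v) = Suc (len (s \<otimes> ev v))"
      using len_cases[of s "ev v"] s ev_closed[OF reduced_lists[OF v(1)]] by auto
    then obtain a c b where *: "v = a @ c # b" "s \<otimes> ev v = ev (a @ b)"
      using exchange[of v s] v s by (auto simp: reduced_def)
    then have "reduced (a @ b)" using l v by (auto simp: reduced_def)
    then show ?thesis using v * by (intro exI[of _ "a @ b"]) auto
  qed
qed


subsection \<open>Dihedral cosets\<close>

text \<open>
  Boolean game on the diagram: firing \<open>s\<close> adds the value at \<open>s\<close> to its neighbours.
  It is the dual reflection representation modulo 2.
\<close>

definition fire :: "'a \<Rightarrow> ('a \<Rightarrow> bool) \<Rightarrow> 'a \<Rightarrow> bool" where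
  "fire s f = (\<lambda>x. f x \<noteq> (x \<in> S \<and> x \<noteq> s \<and> m s x = 3 \<and> f s))"

lemma fire_braid2:
  assumes "s \<in> S" "t \<in> S" "s \<noteq> t" "m s t = 2" 
  shows "fire s (fire t f) = fire t (fire s f)"
  using assms matrix_sym[of s t] by (auto simp: fire_def fun_eq_iff)

lemma fire_braid3:
  assumes "s \<in> S" "t \<in> S" "s \<noteq> t" "m s t = 3" 
  shows "fire s (fire t (fire s f)) = fire t (fire s (fire t f))"
proof
  fix x
  have "m t s = 3" using assms matrix_sym[of s t] by simp
  then show "fire s (fire t (fire s f)) x = fire t (fire s (fire t f)) x"
    using assms by (cases "x = s"; cases "x = t"; cases "m s x = 3"; cases "m t x = 3";
      cases "f s"; cases "f t"; cases "x \<in> S"; simp add: fire_def)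
qed

lemma fire_coxeter_equiv:
  "coxeter_equiv S m u v \<Longrightarrow> foldr fire u f = foldr fire v f"
proof (induction arbitrary: f rule: coxeter_equiv.induct)
  case (square u v s)
  have "fire s (fire s g) = g" for g by (auto simp: fire_def fun_eq_iff)
  then show ?case by simp
next
  case (braid u v s t n)
  then show ?case
    using m_cases[of s t] fire_braid2[of s t] fire_braid3[of s t]
    by (auto simp: numeral_eq_enat alternating_two alternating_three)
qed auto

text \<open>The relations could conceivably make s and t commute. The game on the diagram obeys all
  relations and still tells the two words apart.\<close>

lemma braid3_not_comm:
  assumes "s \<in> S" "t \<in> S" "s \<noteq> t" "m s t = 3"
  shows "s \<otimes> t \<noteq> t \<otimes> s"
proof
  assume "s \<otimes> t = t \<otimes> s"
  then have "coxeter_equiv S m [s, t] [t, s]"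
    using presented[of "[s, t]" "[t, s]"] assms by simp
  \<comment> \<open>Starting from the value at s alone, firing t and then s leaves s on, whereas
    firing s and then t switches s off.\<close>
  from fire_coxeter_equiv[OF this, of "\<lambda>x. x = s"] have
    "fire s (fire t (\<lambda>x. x = s)) s = fire t (fire s (\<lambda>x. x = s)) s" by simp
  then show False using assms matrix_sym[of s t] by (auto simp: fire_def)
qed

text \<open>Exchange with t in a reduced word \<open>s # u\<close> of w: deleting the first letter
  would give t w = s w, so the deletion takes place in u and s stays in front.\<close>

lemma two_descents:
  assumes "s \<in> S" "t \<in> S" "s \<noteq> t" "w \<in> carrier W" "len (s \<otimes> w) < len w" "len (t \<otimes> w) < len w"
  shows "\<exists>x \<in> carrier W. w = t \<otimes> (s \<otimes> x) \<and> len w = len x + 2"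
proof -
  obtain u where u: "reduced u" "ev u = s \<otimes> w" using reduced_exists[of "s \<otimes> w"] assms by auto
  then have uS: "u \<in> lists S" and w: "w = ev (s # u)" using assms by (auto simp: reduced_def)
  have lw: "len w = Suc (length u)" using u len_cases[of s w] assms by (auto simp: reduced_def)
  obtain a c b where *: "s # u = a @ c # b" "t \<otimes> w = ev (a @ b)"
    using exchange[of "s # u" t] uS assms w by (metis Cons_in_lists_iff)
  have "a \<noteq> []"
  proof
    assume "a = []"
    then have "b = u" using *(1) by simp
    then have "t \<otimes> w = s \<otimes> w" using \<open>a = []\<close> *(2) u by simp
    then show False using assms by simp
  qed
  then obtain a' where a: "a = s # a'" "u = a' @ c # b" using * by (cases a) auto
  then have L: "a' @ b \<in> lists S" using uS by auto
  then have w2: "w = t \<otimes> (s \<otimes> ev (a' @ b))"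
    using *(2) a assms by (metis gen_cancel append_Cons list_prod_Cons)
  have "len (ev (a' @ b)) \<le> length (a' @ b)" using len_le L by blast
  moreover have "len w \<le> Suc (Suc (len (ev (a' @ b))))"
    using w2 len_mult_le[of t "s \<otimes> ev (a' @ b)"] len_mult_le[of s "ev (a' @ b)"] L assms by simp
  ultimately have "len w = len (ev (a' @ b)) + 2" using lw a by simp
  then show ?thesis using w2 L by (intro bexI[of _ "ev (a' @ b)"]) auto
qed

text \<open>A further exchange, now with s in the word \<open>t # s # u\<close>. Deleting the first
  letter would give w = x, deleting the second would make s and t commute, so the deletion takes
  place in u.\<close>

lemma two_descents3:
  assumes "s \<in> S" "t \<in> S" "s \<noteq> t" "w \<in> carrier W" "len (s \<otimes> w) < len w" "len (t \<otimes> w) < len w"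
    "m s t = 3"
  shows "\<exists>x \<in> carrier W. w = s \<otimes> (t \<otimes> (s \<otimes> x)) \<and> len w = len x + 3"
proof -
  obtain x where x: "x \<in> carrier W" "w = t \<otimes> (s \<otimes> x)" "len w = len x + 2"
    using two_descents assms by blast
  obtain u where u: "reduced u" "ev u = x" using reduced_exists x by blast
  then have uS: "u \<in> lists S" and lu: "length u = len x" by (auto simp: reduced_def)
  have w: "w = ev (t # s # u)" using u x by simp
  obtain a c b where *: "t # s # u = a @ c # b" "s \<otimes> w = ev (a @ b)"
    using exchange[of "t # s # u" s] uS assms w by (metis Cons_in_lists_iff)
  consider "a = []" | "a = [t]" | a' where "a = t # s # a'"
    using * by (cases a; cases "tl a") auto
  then show ?thesis
  proof cases
    case 1
    then have "b = s # u" using *(1) by simp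
    then have "s \<otimes> w = s \<otimes> x" using 1 *(2) u by simp
    then show ?thesis using x assms by simp
  next
    case 2
    then have "b = u" using *(1) by simp
    then have "s \<otimes> w = t \<otimes> x" using 2 *(2) u by simp
    then have "t \<otimes> (s \<otimes> x) = s \<otimes> (t \<otimes> x)" using x assms by (metis gen_cancel gen_closed m_closed)
    then have "t \<otimes> s \<otimes> x = s \<otimes> t \<otimes> x" using x assms by (simp add: m_assoc)
    then show ?thesis using braid3_not_comm[of s t] x assms by simp
  next
    case 3
    then have a: "u = a' @ c # b" using * by simp
    then have L: "a' @ b \<in> lists S" using uS by auto
    then have w2: "w = s \<otimes> (t \<otimes> (s \<otimes> ev (a' @ b)))"
      using *(2) 3 assms by (metis gen_cancel append_Cons list_prod_Cons)
    have "len (ev (a' @ b)) \<le> length (a' @ b)" using len_le L by blast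
    moreover have "len w \<le> Suc (Suc (Suc (len (ev (a' @ b)))))"
      using w2 len_mult_le[of s "t \<otimes> (s \<otimes> ev (a' @ b))"] len_mult_le[of t "s \<otimes> ev (a' @ b)"]
        len_mult_le[of s "ev (a' @ b)"] L assms by simp
    ultimately have "len w = len (ev (a' @ b)) + 3" using lu x a by simp
    then show ?thesis using w2 L by (intro bexI[of _ "ev (a' @ b)"]) auto
  qed
qed


subsection \<open>Matsumoto's theorem\<close>

text \<open>The congruence of words without cancellation of squares. This part is shared by W and
  the Hecke algebra, whose generators satisfy the braid relations but need not be
  involutions.\<close>

inductive braid_equiv :: "'a list \<Rightarrow> 'a list \<Rightarrow> bool" where
  refl: "braid_equiv u u"
| trans: "braid_equiv u v \<Longrightarrow> braid_equiv v w \<Longrightarrow> braid_equiv u w"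
| Cons: "braid_equiv u v \<Longrightarrow> s \<in> S \<Longrightarrow> braid_equiv (s # u) (s # v)"
| braid: "s \<in> S \<Longrightarrow> t \<in> S \<Longrightarrow> s \<noteq> t \<Longrightarrow> m s t = enat n \<Longrightarrow> u \<in> lists S \<Longrightarrow>
    braid_equiv (alternating n s t @ u) (alternating n t s @ u)"

text \<open>Distinct first letters s and t are both descents of the element, which therefore has
  reduced words s t y and t s y, or s t s y and t s t y. These differ by one braid move, and each
  shares its first letter with one of the given words, so induction on the length applies to the
  tails.\<close>

lemma matsumoto:
  "\<lbrakk>reduced u; reduced v; ev u = ev v\<rbrakk> \<Longrightarrow> braid_equiv u v"
proof (induction "length u" arbitrary: u v rule: less_induct)
  case less
  have lenuv: "length u = length v" using less.prems by (auto simp: reduced_def)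
  show ?case
  proof (cases u)
    case Nil
    then show ?thesis using lenuv braid_equiv.refl by simp
  next
    case (Cons s u')
    then obtain t v' where v: "v = t # v'" using lenuv by (cases v) auto
    have S: "s \<in> S" "t \<in> S" "u' \<in> lists S" "v' \<in> lists S"
      using less.prems Cons v by (auto simp: reduced_def)
    have red: "reduced u'" "reduced v'" using less.prems Cons v reduced_tl by blast+
    have IH: "braid_equiv u' y" if "reduced y" "ev y = ev u'" for y
      using less.hyps[of u' y] that Cons red by simp
    \<comment> \<open>Oriented towards \<open>v'\<close> because \<open>braid_equiv\<close> has no
      symmetry rule and the chain has to end at v.\<close>
    have IH': "braid_equiv y v'" if "reduced y" "ev y = ev v'" for y
    proof -
      have "length y = length v'" using that red by (auto simp: reduced_def)
      then show ?thesis using less.hyps[of y v'] that v lenuv red by simp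
    qed
    show ?thesis
    proof (cases "s = t")
      case True
      then have "ev u' = ev v'" using less.prems Cons v S by simp
      then show ?thesis using IH[of v'] red True Cons v braid_equiv.Cons S by metis
    next
      case False
      define w where "w = ev u"
      have w: "w \<in> carrier W" "s \<otimes> w = ev u'" "t \<otimes> w = ev v'"
        using less.prems(3) Cons v S by (simp_all add: w_def)
          (metis gen_cancel ev_closed)
      have lw: "len w = Suc (length u')" "len w = Suc (length v')"
        using less.prems Cons v by (auto simp: w_def reduced_def)
      have d: "len (s \<otimes> w) < len w" "len (t \<otimes> w) < len w"
        using w lw red by (auto simp: reduced_def)
      consider "m s t = 2" | "m s t = 3" using m_cases S False by blast
      then show ?thesis
      proof cases
        case 1
        obtain x where x: "x \<in> carrier W" "w = t \<otimes> (s \<otimes> x)" "len w = len x + 2"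
          using two_descents[of s t w] S False w d by blast
        obtain y where y: "reduced y" "ev y = x" using reduced_exists x by blast
        then have yS: "y \<in> lists S" and ly: "length y = len x" by (auto simp: reduced_def)
        have wst: "w = s \<otimes> (t \<otimes> x)"
          using x braid2[of s t] S False 1 by (simp flip: m_assoc)
        have eu: "ev (t # y) = ev u'" using w wst y S by (metis gen_cancel list_prod_Cons x(1) gen_closed m_closed)
        have ev': "ev (s # y) = ev v'" using w x y S by (metis gen_cancel list_prod_Cons gen_closed m_closed)
        have "reduced (t # y)" "reduced (s # y)"
          using eu ev' S yS ly lw x(3) red by (auto simp: reduced_def)
        then have "braid_equiv u (s # t # y)" "braid_equiv (t # s # y) v"
          using IH[of "t # y"] IH'[of "s # y"] eu ev' Cons v S by (auto intro: braid_equiv.Cons)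
        moreover have "braid_equiv (s # t # y) (t # s # y)"
          using braid_equiv.braid[of s t 2 y] S False 1 yS by (simp add: alternating_two numeral_eq_enat)
        ultimately show ?thesis using braid_equiv.trans by blast
      next
        case 2
        obtain x where x: "x \<in> carrier W" "w = s \<otimes> (t \<otimes> (s \<otimes> x))" "len w = len x + 3"
          using two_descents3[of s t w] S False w d 2 by blast
        obtain y where y: "reduced y" "ev y = x" using reduced_exists x by blast
        then have yS: "y \<in> lists S" and ly: "length y = len x" by (auto simp: reduced_def)
        have wst: "w = t \<otimes> (s \<otimes> (t \<otimes> x))"
          using x braid3[of s t] S False 2 by (simp flip: m_assoc)
        have eu: "ev (t # s # y) = ev u'" using w x y S by (metis gen_cancel list_prod_Cons gen_closed m_closed)
        have ev': "ev (s # t # y) = ev v'" using w wst x y S by (metis gen_cancel list_prod_Cons gen_closed m_closed)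
        have "reduced (t # s # y)" "reduced (s # t # y)"
          using eu ev' S yS ly lw x(3) red by (auto simp: reduced_def)
        then have "braid_equiv u (s # t # s # y)" "braid_equiv (t # s # t # y) v"
          using IH[of "t # s # y"] IH'[of "s # t # y"] eu ev' Cons v S by (auto intro: braid_equiv.Cons)
        moreover have "braid_equiv (s # t # s # y) (t # s # t # y)"
          using braid_equiv.braid[of s t 3 y] S False 2 yS by (simp add: alternating_three numeral_eq_enat)
        ultimately show ?thesis using braid_equiv.trans by blast
      qed
    qed
  qed
qed

section \<open>Supports and parabolic subgroups with disjoint generators\<close>

lemma braid_equiv_set: "braid_equiv u v \<Longrightarrow> set u = set v"
proof (induction rule: braid_equiv.induct)
  case (braid s t n u)
  then show ?case using m_cases[of s t]
    by (auto simp: numeral_eq_enat alternating_two alternating_three)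
qed auto

text \<open>Braid moves have length 2 or 3, so both letters occur on both sides. This makes the
  support of an element well defined and passes from some reduced expression to the chosen
  one.\<close>

lemma reduced_set: "\<lbrakk>reduced u; reduced v; ev u = ev v\<rbrakk> \<Longrightarrow> set u = set v"
  using matsumoto braid_equiv_set by blast

text \<open>Reducing both words adds no letters, so the support of the common value lies in both
  letter sets and is empty.\<close>

lemma disjoint_words:
  assumes "u \<in> lists S" "v \<in> lists S" "set u \<inter> set v = {}" "ev u = ev v"
  shows "ev u = \<one>"
proof -
  obtain u' v' where *: "reduced u'" "ev u' = ev u" "set u' \<subseteq> set u"
    "reduced v'" "ev v' = ev v" "set v' \<subseteq> set v"
    using reduced_subword assms by meson
  then have "set u' = set v'" using reduced_set[of u' v'] assms by simp
  then have "set u' \<subseteq> set u \<inter> set v" using *(3,6) by simp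
  then have "set u' = {}" using assms(3) by simp
  then show ?thesis using *(2) by auto
qed

text \<open>If a letter s in front shortened u v, exchange would delete a letter of u or of v. In u,
  cancelling v contradicts that \<open>s # u\<close> is reduced. In v, the conjugate of s by u lies
  in two parabolic subgroups with disjoint generators, so it is trivial, which is absurd.\<close>

lemma reduced_append:
  assumes "reduced u" "reduced v" "set u \<inter> set v = {}"
  shows "reduced (u @ v)"
  using assms
proof (induction u)
  case (Cons s u)
  have red: "reduced u" "reduced (u @ v)" using Cons reduced_tl by auto
  have S: "s \<in> S" "u \<in> lists S" "v \<in> lists S" using Cons.prems by (auto simp: reduced_def)
  have up: "len (s \<otimes> ev u) = Suc (len (ev u))" using reduced_Cons_up Cons by blast
  have "len (ev (u @ v)) < len (s \<otimes> ev (u @ v))"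
  proof (rule ccontr)
    assume "\<not> ?thesis"
    then have "len (s \<otimes> ev (u @ v)) < len (ev (u @ v))"
      using len_cases[of s "ev (u @ v)"] S by auto
    then obtain a c b where *: "u @ v = a @ c # b" "s \<otimes> ev (u @ v) = ev (a @ b)"
      using exchange[of "u @ v" s] S by auto
    from *(1) consider b' where "u = a @ c # b'" "b = b' @ v" | a' where "a = u @ a'" "v = a' @ c # b"
      by (auto simp: append_eq_append_conv2 append_eq_Cons_conv)
    then show False
    proof cases
      case (1 b')
      then have L: "a @ b' \<in> lists S" using S by auto
      have "s \<otimes> ev u \<otimes> ev v = ev (a @ b') \<otimes> ev v"
        using *(2) S L 1 ev_append[of u v] ev_append[of "a @ b'" v] by (simp add: m_assoc)
      then have "s \<otimes> ev u = ev (a @ b')" using S L by simp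
      then show False using up len_le[OF L] 1 red by (simp add: reduced_def)
    next
      case (2 a')
      then have L: "a' @ b \<in> lists S" using S by auto
      have "s \<otimes> ev u \<otimes> ev v = ev u \<otimes> ev (a' @ b)"
        using *(2) S L 2 ev_append[of u v] ev_append[of u "a' @ b"] by (simp add: m_assoc)
      then have "inv (ev u) \<otimes> (s \<otimes> ev u) \<otimes> ev v = ev (a' @ b)"
        using S L by (simp add: m_assoc) (simp flip: m_assoc)
      then have "inv (ev u) \<otimes> (s \<otimes> ev u) = ev (a' @ b) \<otimes> inv (ev v)"
        using S L inv_solve_right[of "inv (ev u) \<otimes> (s \<otimes> ev u)" "ev (a' @ b)" "ev v"] by simp
      then have "ev (rev u @ [s] @ u) = ev ((a' @ b) @ rev v)"
        using S L ev_append[of "a' @ b" "rev v"] ev_append[of "rev u" "s # u"] by (simp add: ev_rev)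
      then have "ev (rev u @ [s] @ u) = \<one>"
        using disjoint_words[of "rev u @ [s] @ u" "(a' @ b) @ rev v"] S 2 Cons.prems by auto
      then have "inv (ev u) \<otimes> (s \<otimes> ev u) = \<one>"
        using S ev_append[of "rev u" "s # u"] by (simp add: ev_rev)
      then have "s \<otimes> ev u = ev u" using S inv_solve_left[of \<one> "ev u" "s \<otimes> ev u"] by simp
      then show False using up by simp
    qed
  qed
  then show ?case using reduced_Cons red S by simp
qed simp

end


section \<open>Representations of the Hecke algebra\<close>

lemma poly_mapping_sum_single:
  fixes p :: "'k \<Rightarrow>\<^sub>0 'c::comm_monoid_add"
  shows "p = (\<Sum>w\<in>Poly_Mapping.keys p. Poly_Mapping.single w (Poly_Mapping.lookup p w))"
  by (rule poly_mapping_eqI)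
    (auto simp: lookup_sum lookup_single when_def in_keys_iff sum.If_cases sum.delta')

lemma poly_mapping_induct_single [case_names zero single add]:
  fixes p :: "'k \<Rightarrow>\<^sub>0 'c::comm_monoid_add"
  assumes "P 0" "\<And>w c. P (Poly_Mapping.single w c)" "\<And>p r. P p \<Longrightarrow> P r \<Longrightarrow> P (p + r)"
  shows "P p"
proof -
  have "P (\<Sum>w\<in>F. Poly_Mapping.single w (Poly_Mapping.lookup p w))" if "finite F" for F
    using that assms by induction auto
  then show ?thesis by (subst poly_mapping_sum_single[of p]) simp
qed

definition linear_op :: "(('x \<Rightarrow> 'f::field) \<Rightarrow> 'x \<Rightarrow> 'f) \<Rightarrow> bool" where
  "linear_op T \<longleftrightarrow> (\<forall>g h. T (\<lambda>x. g x + h x) = (\<lambda>x. T g x + T h x)) \<and>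
     (\<forall>c g. T (\<lambda>x. c * g x) = (\<lambda>x. c * T g x))"

lemma linear_op_add: "linear_op T \<Longrightarrow> T (\<lambda>x. g x + h x) = (\<lambda>x. T g x + T h x)"
  and linear_op_scale: "linear_op T \<Longrightarrow> T (\<lambda>x. c * g x) = (\<lambda>x. c * T g x)"
  by (auto simp: linear_op_def)

lemma linear_op_zero: "linear_op T \<Longrightarrow> T (\<lambda>x. 0) = (\<lambda>x. 0)"
  using linear_op_scale[of T 0 "\<lambda>x. 0"] by simp

lemma linear_op_foldr: "(\<And>s. linear_op (X s)) \<Longrightarrow> linear_op (foldr X u)"
  by (induction u) (auto simp: linear_op_def)

locale operators =
  fixes X :: "'a \<Rightarrow> ('x \<Rightarrow> 'f::field) \<Rightarrow> 'x \<Rightarrow> 'f"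
  assumes linear: "linear_op (X s)"
begin

definition rep :: "('a free_monoid \<Rightarrow>\<^sub>0 'f) \<Rightarrow> ('x \<Rightarrow> 'f) \<Rightarrow> 'x \<Rightarrow> 'f" where
  "rep p g x = (\<Sum>w\<in>Poly_Mapping.keys p. Poly_Mapping.lookup p w * foldr X (letters w) g x)"

lemma rep_zero [simp]: "rep 0 g x = 0"
  by (simp add: rep_def)

lemma rep_add: "rep (p + r) g x = rep p g x + rep r g x"
  unfolding rep_def by (rule setsum_keys_plus_distrib) (simp_all add: algebra_simps)

lemma rep_single: "rep (Poly_Mapping.single w c) g x = c * foldr X (letters w) g x"
  by (simp add: rep_def)

lemma rep_monomial: "rep (monomial u) g x = foldr X u g x"
  by (simp add: monomial_def rep_single)

lemma rep_scalar: "rep (scalar c) g x = c * g x"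
  by (simp add: scalar_def rep_single zero_free_monoid_def)

lemma rep_one: "rep 1 g x = g x"
  using rep_scalar[of 1] by (simp add: scalar_one)

lemma rep_uminus: "rep (- p) g x = - rep p g x"
  using rep_add[of p "- p" g x] by (simp add: eq_neg_iff_add_eq_0 add.commute)

lemma rep_minus: "rep (p - r) g x = rep p g x - rep r g x"
  using rep_add[of p "- r" g x] by (simp add: rep_uminus)

lemma linear_op_rep: "linear_op (rep p)"
proof (induction p rule: poly_mapping_induct_single)
  case (single w c)
  then show ?case using linear_op_foldr[of X "letters w", OF linear]
    by (auto simp: linear_op_def rep_single algebra_simps fun_eq_iff)
qed (auto simp: linear_op_def rep_add algebra_simps fun_eq_iff)

lemma rep_mult: "rep (p * r) g = rep p (rep r g)"
proof (induction p rule: poly_mapping_induct_single)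
  case (single w c)
  show ?case
  proof (induction r rule: poly_mapping_induct_single)
    case zero
    show ?case using linear_op_zero[OF linear_op_rep] by (auto simp: fun_eq_iff)
  next
    case (single v d)
    show ?case
      using linear_op_scale[OF linear_op_foldr[of X "letters w", OF linear], of d "foldr X (letters v) g"]
      by (simp add: fun_eq_iff mult_single rep_single plus_free_monoid_def)
  next
    case (add r1 r2)
    then show ?case
      using linear_op_add[OF linear_op_rep, of "Poly_Mapping.single w c" "rep r1 g" "rep r2 g"]
      by (simp add: fun_eq_iff rep_add distrib_left)
  qed
qed (auto simp: fun_eq_iff rep_add distrib_right)

definition kernel :: "'a set \<Rightarrow> ('a free_monoid \<Rightarrow>\<^sub>0 'f) set" where
  "kernel S = {p \<in> carrier (free_algebra S). \<forall>g x. rep p g x = 0}"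

lemma ideal_kernel: "ideal (kernel S) (free_algebra S)"
proof (rule idealI)
  show "ring (free_algebra S :: ('f, 'a free_monoid \<Rightarrow>\<^sub>0 'f) module)" by (rule ring_free_algebra)
  interpret A: ring "free_algebra S :: ('f, 'a free_monoid \<Rightarrow>\<^sub>0 'f) module" by (rule ring_free_algebra)
  show "subgroup (kernel S) (add_monoid (free_algebra S))"
  proof (rule A.add.subgroupI)
    show "kernel S \<subseteq> carrier (free_algebra S)" by (auto simp: kernel_def)
    show "kernel S \<noteq> {}" by (auto simp: kernel_def intro!: exI[of _ 0])
  next
    fix p assume p: "p \<in> kernel S"
    then have pc: "p \<in> carrier (free_algebra S)" by (simp add: kernel_def)
    have "\<ominus>\<^bsub>free_algebra S\<^esub> p = - p"
      using A.minus_equality[of "- p" p] pc uminus_closed[OF pc] by simp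
    then show "\<ominus>\<^bsub>free_algebra S\<^esub> p \<in> kernel S"
      using p uminus_closed[OF pc] by (simp add: kernel_def rep_uminus)
  next
    fix p r assume "p \<in> kernel S" "r \<in> kernel S"
    then show "p \<oplus>\<^bsub>free_algebra S\<^esub> r \<in> kernel S"
      using free_algebra_add_closed[of p S r] by (simp add: kernel_def rep_add)
  qed
next
  fix p r :: "'a free_monoid \<Rightarrow>\<^sub>0 'f" assume "p \<in> kernel S" "r \<in> carrier (free_algebra S)"
  then show "r \<otimes>\<^bsub>free_algebra S\<^esub> p \<in> kernel S" "p \<otimes>\<^bsub>free_algebra S\<^esub> r \<in> kernel S"
    using free_algebra_mult_closed[of p S r] free_algebra_mult_closed[of r S p] linear_op_zero[OF linear_op_rep, of r]
    by (auto simp: kernel_def rep_mult) (metis (no_types, lifting) ext)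
qed

end

text \<open>The relation (T - 1)(T + q) = 0 appears here solved for the square of T.\<close>

locale hecke_operators = operators X for X :: "'a \<Rightarrow> ('x \<Rightarrow> 'f::field) \<Rightarrow> 'x \<Rightarrow> 'f" +
  fixes S :: "'a set" and m :: "'a \<Rightarrow> 'a \<Rightarrow> enat" and q :: "'a \<Rightarrow> 'f"
  assumes quadratic: "s \<in> S \<Longrightarrow> X s (X s g) x = (1 - q s) * X s g x + q s * g x"
    and braid: "\<lbrakk>s \<in> S; t \<in> S; s \<noteq> t; m s t = enat n\<rbrakk> \<Longrightarrow>
      foldr X (alternating n s t) g x = foldr X (alternating n t s) g x"
begin

text \<open>The universal property of the presentation: the kernel is an ideal, so it is enough that
  the relators act as zero.\<close>

lemma hecke_ideal_kernel: "hecke_ideal S m q \<subseteq> kernel S"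
proof -
  have "hecke_relators S m q \<subseteq> kernel S"
  proof
    fix p assume p: "p \<in> hecke_relators S m q"
    have "rep p g x = 0" for g x
    proof -
      from p consider s where "s \<in> S" "p = (monomial [s] - 1) * (monomial [s] + scalar (q s))"
        | s t n where "s \<in> S" "t \<in> S" "s \<noteq> t" "m s t = enat n"
          "p = monomial (alternating n s t) - monomial (alternating n t s)"
        unfolding hecke_relators_def by blast
      then show ?thesis
      proof cases
        case (1 s)
        have "rep p g x = rep (monomial [s]) (rep (monomial [s] + scalar (q s)) g) x
            - rep (monomial [s] + scalar (q s)) g x"
          by (simp only: 1 rep_mult rep_minus rep_one)
        moreover have "rep (monomial [s] + scalar (q s)) g = (\<lambda>x. X s g x + q s * g x)"
          by (simp add: fun_eq_iff rep_add rep_monomial rep_scalar)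
        moreover have "X s (\<lambda>x. X s g x + q s * g x) = (\<lambda>x. X s (X s g) x + q s * X s g x)"
          using linear_op_add[OF linear] linear_op_scale[OF linear] by metis
        ultimately have "rep p g x = X s (X s g) x + q s * X s g x - (X s g x + q s * g x)"
          by (simp add: rep_monomial)
        then show ?thesis using quadratic[OF 1(1), of g x] by (simp add: algebra_simps)
      next
        case (2 s t n)
        then show ?thesis using braid by (simp add: rep_minus rep_monomial)
      qed
    qed
    then show "p \<in> kernel S" unfolding kernel_def using p hecke_relators_closed[of S m q] by blast
  qed
  then show ?thesis
    unfolding hecke_ideal_def by (rule ring.genideal_minimal[OF ring_free_algebra ideal_kernel])
qed

end

section \<open>Arithmetic of classes in the quotient\<close>

definition hecke_class :: "'a set \<Rightarrow> ('a \<Rightarrow> 'a \<Rightarrow> enat) \<Rightarrow> ('a \<Rightarrow> 'f::field) \<Rightarrow>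
   ('a free_monoid \<Rightarrow>\<^sub>0 'f) \<Rightarrow> ('a free_monoid \<Rightarrow>\<^sub>0 'f) set" where
  "hecke_class S m q p = hecke_ideal S m q +>\<^bsub>free_algebra S\<^esub> p"

lemma
  fixes q :: "'a \<Rightarrow> 'f::field"
  shows carrier_hecke_algebra: "carrier (hecke_algebra S m q) = hecke_class S m q ` carrier (free_algebra S)"
    and hecke_class_add: "\<lbrakk>p \<in> carrier (free_algebra S); r \<in> carrier (free_algebra S)\<rbrakk> \<Longrightarrow>
      hecke_class S m q p \<oplus>\<^bsub>hecke_algebra S m q\<^esub> hecke_class S m q r = hecke_class S m q (p + r)"
    and hecke_class_mult: "\<lbrakk>p \<in> carrier (free_algebra S); r \<in> carrier (free_algebra S)\<rbrakk> \<Longrightarrow>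
      hecke_class S m q p \<otimes>\<^bsub>hecke_algebra S m q\<^esub> hecke_class S m q r = hecke_class S m q (p * r)"
    and hecke_class_smult: "p \<in> carrier (free_algebra S) \<Longrightarrow>
      c \<odot>\<^bsub>hecke_algebra S m q\<^esub> hecke_class S m q p = hecke_class S m q (scalar c * p)"
    and hecke_class_one: "\<one>\<^bsub>hecke_algebra S m q\<^esub> = hecke_class S m q 1"
    and hecke_class_zero: "\<zero>\<^bsub>hecke_algebra S m q\<^esub> = hecke_class S m q 0"
    and hecke_class_eq_iff: "\<lbrakk>p \<in> carrier (free_algebra S); r \<in> carrier (free_algebra S)\<rbrakk> \<Longrightarrow>
      hecke_class S m q p = hecke_class S m q r \<longleftrightarrow> p - r \<in> hecke_ideal S m q"
proof -
  interpret I: ideal "hecke_ideal S m q" "free_algebra S" by (rule ideal_hecke_ideal)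
  let ?A = "free_algebra S :: ('f, 'a free_monoid \<Rightarrow>\<^sub>0 'f) module"
  show "carrier (hecke_algebra S m q) = hecke_class S m q ` carrier ?A"
    unfolding hecke_class_def
    by (auto simp: hecke_algebra_def Let_def FactRing_def A_RCOSETS_def' simp del: free_algebra_simps)
  show "hecke_class S m q p \<oplus>\<^bsub>hecke_algebra S m q\<^esub> hecke_class S m q r = hecke_class S m q (p + r)"
    if "p \<in> carrier ?A" "r \<in> carrier ?A" for p r
    using I.a_rcos_sum[OF that] by (simp add: hecke_class_def hecke_algebra_def Let_def FactRing_def)
  show "hecke_class S m q p \<otimes>\<^bsub>hecke_algebra S m q\<^esub> hecke_class S m q r = hecke_class S m q (p * r)"
    if "p \<in> carrier ?A" "r \<in> carrier ?A" for p r
    using I.rcoset_mult_add[OF that] by (simp add: hecke_class_def hecke_algebra_def Let_def FactRing_def)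
  show "c \<odot>\<^bsub>hecke_algebra S m q\<^esub> hecke_class S m q p = hecke_class S m q (scalar c * p)"
    if "p \<in> carrier ?A"
    unfolding hecke_class_def by (rule hecke_smult_coset[OF that])
  show "\<one>\<^bsub>hecke_algebra S m q\<^esub> = hecke_class S m q 1"
    by (simp add: hecke_class_def hecke_algebra_def Let_def FactRing_def)
  show "\<zero>\<^bsub>hecke_algebra S m q\<^esub> = hecke_class S m q 0"
    by (simp add: hecke_class_def hecke_algebra_def Let_def FactRing_def a_r_coset_def')
  show "hecke_class S m q p = hecke_class S m q r \<longleftrightarrow> p - r \<in> hecke_ideal S m q"
    if "p \<in> carrier ?A" "r \<in> carrier ?A" for p r
  proof -
    have "\<ominus>\<^bsub>?A\<^esub> r = - r"
      using I.minus_equality[of "- r" r] that uminus_closed[OF that(2)] by simp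
    then have "p \<ominus>\<^bsub>?A\<^esub> r = p - r" by (simp add: a_minus_def)
    then show ?thesis
      unfolding hecke_class_def using I.quotient_eq_iff_same_a_r_cos[OF ideal_hecke_ideal that] by simp
  qed
qed

context hecke_operators
begin

text \<open>Descends to a linear form on the Hecke algebra because \<^const>\<open>rep\<close> annihilates the ideal.\<close>

definition hecke_form :: "('x \<Rightarrow> 'f) \<Rightarrow> 'x \<Rightarrow> ('a free_monoid \<Rightarrow>\<^sub>0 'f) set \<Rightarrow> 'f" where
  "hecke_form g x Y = rep (SOME p. p \<in> carrier (free_algebra S) \<and> hecke_class S m q p = Y) g x"

lemma hecke_form_class:
  assumes "p \<in> carrier (free_algebra S)"
  shows "hecke_form g x (hecke_class S m q p) = rep p g x"
proof -
  let ?r = "SOME r. r \<in> carrier (free_algebra S) \<and> hecke_class S m q r = hecke_class S m q p"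
  have r: "?r \<in> carrier (free_algebra S) \<and> hecke_class S m q ?r = hecke_class S m q p"
    using someI[of "\<lambda>r. r \<in> carrier (free_algebra S) \<and> hecke_class S m q r = hecke_class S m q p" p] assms
    by simp
  then have "?r - p \<in> hecke_ideal S m q" using hecke_class_eq_iff[of ?r S p m q] assms by simp
  then have "rep (?r - p) g x = 0" using hecke_ideal_kernel unfolding kernel_def by blast
  then show ?thesis by (simp add: hecke_form_def rep_minus)
qed

lemma hecke_form_add:
  assumes "Y \<in> carrier (hecke_algebra S m q)" "Z \<in> carrier (hecke_algebra S m q)"
  shows "hecke_form g x (Y \<oplus>\<^bsub>hecke_algebra S m q\<^esub> Z) = hecke_form g x Y + hecke_form g x Z"
  using assms
  by (auto simp: carrier_hecke_algebra hecke_class_add hecke_form_class rep_add free_algebra_add_closed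
    simp del: free_algebra_simps)

lemma hecke_form_smult:
  assumes "Y \<in> carrier (hecke_algebra S m q)"
  shows "hecke_form g x (c \<odot>\<^bsub>hecke_algebra S m q\<^esub> Y) = c * hecke_form g x Y"
  using assms
  by (auto simp: carrier_hecke_algebra hecke_class_smult hecke_form_class rep_mult rep_scalar
    free_algebra_mult_closed[OF scalar_closed]
    simp del: free_algebra_simps)

end

section \<open>Dihedral cosets and the transposed regular representation\<close>

context simply_laced_coxeter
begin

text \<open>If s shortened t y, then t y would have both descents and equal t s x. Then y = s x with
  x shorter than y, so s would shorten y.\<close>

lemma len_second_up:
  assumes "s \<in> S" "t \<in> S" "s \<noteq> t" "y \<in> carrier W" "len y < len (s \<otimes> y)" "len y < len (t \<otimes> y)"
  shows "len (s \<otimes> (t \<otimes> y)) = Suc (len (t \<otimes> y))"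
proof (rule ccontr)
  assume *: "\<not> ?thesis"
  have "len (s \<otimes> (t \<otimes> y)) < len (t \<otimes> y)" using * len_cases[of s "t \<otimes> y"] assms by auto
  moreover have "len (t \<otimes> (t \<otimes> y)) < len (t \<otimes> y)" using assms by simp
  ultimately obtain x where x: "x \<in> carrier W" "t \<otimes> y = t \<otimes> (s \<otimes> x)" "len (t \<otimes> y) = len x + 2"
    using two_descents[of s t "t \<otimes> y"] assms by auto
  then have "y = s \<otimes> x" using assms by simp
  then show False using x assms len_cases[of t y] by auto
qed

lemma len_third_up:
  assumes "s \<in> S" "t \<in> S" "s \<noteq> t" "y \<in> carrier W" "len y < len (s \<otimes> y)" "len y < len (t \<otimes> y)"
    "m s t = 3"
  shows "len (s \<otimes> (t \<otimes> (s \<otimes> y))) = Suc (len (t \<otimes> (s \<otimes> y)))"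
proof (rule ccontr)
  assume *: "\<not> ?thesis"
  let ?w = "t \<otimes> (s \<otimes> y)"
  have m: "m t s = 3" using matrix_sym assms by metis
  have "len (s \<otimes> ?w) < len ?w" using * len_cases[of s ?w] assms by auto
  moreover have l: "len ?w = Suc (len (s \<otimes> y))" using len_second_up[of t s y] assms by auto
  then have "len (t \<otimes> ?w) < len ?w" using assms by simp
  ultimately obtain x where x: "x \<in> carrier W" "?w = t \<otimes> (s \<otimes> (t \<otimes> x))" "len ?w = len x + 3"
    using two_descents3[of t s ?w] assms m by auto
  then have "y = t \<otimes> x" using assms by simp
  then show False using x l assms len_cases[of s y] by auto
qed

text \<open>Descents s and t are stripped off until none is left. The y so reached is the minimal
  element of the coset, and the stripped part is one of the four elements of the dihedral group
  generated by s and t.\<close>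

lemma coset2:
  assumes "s \<in> S" "t \<in> S" "s \<noteq> t" "m s t = 2" "x \<in> carrier W"
  shows "\<exists>y \<in> carrier W. len y < len (s \<otimes> y) \<and> len y < len (t \<otimes> y) \<and>
    x \<in> {y, s \<otimes> y, t \<otimes> y, s \<otimes> (t \<otimes> y)}"
  using assms(5)
proof (induction "len x" arbitrary: x rule: less_induct)
  case less
  have c: "t \<otimes> (s \<otimes> y) = s \<otimes> (t \<otimes> y)" if "y \<in> carrier W" for y
    using braid2[of s t] assms that by (simp flip: m_assoc)
  have step: ?case if rst: "r \<in> {s, t}" "len (r \<otimes> x) < len x" for r
  proof -
    have r: "r \<in> S" using rst assms by auto
    obtain y where y: "y \<in> carrier W" "len y < len (s \<otimes> y)" "len y < len (t \<otimes> y)"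
      "r \<otimes> x \<in> {y, s \<otimes> y, t \<otimes> y, s \<otimes> (t \<otimes> y)}"
      using less(1)[OF rst(2)] r less.prems by auto
    have "x = r \<otimes> (r \<otimes> x)" using r less.prems by simp
    then have "x \<in> (\<otimes>) r ` {y, s \<otimes> y, t \<otimes> y, s \<otimes> (t \<otimes> y)}" using y(4) by blast
    then show ?thesis using y(1-3) rst(1) assms c[OF y(1)] c[of "t \<otimes> y"]
      by (intro bexI[of _ y]) auto
  qed
  show ?case
  proof (cases "len x < len (s \<otimes> x) \<and> len x < len (t \<otimes> x)")
    case True
    then show ?thesis using less.prems by (intro bexI[of _ x]) auto
  next
    case False
    then have "len (s \<otimes> x) < len x \<or> len (t \<otimes> x) < len x"
      using len_cases[of s x] len_cases[of t x] assms less.prems by auto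
    then show ?thesis using step by blast
  qed
qed

lemma coset3:
  assumes "s \<in> S" "t \<in> S" "s \<noteq> t" "m s t = 3" "x \<in> carrier W"
  shows "\<exists>y \<in> carrier W. len y < len (s \<otimes> y) \<and> len y < len (t \<otimes> y) \<and>
    x \<in> {y, s \<otimes> y, t \<otimes> y, s \<otimes> (t \<otimes> y), t \<otimes> (s \<otimes> y), s \<otimes> (t \<otimes> (s \<otimes> y))}"
  using assms(5)
proof (induction "len x" arbitrary: x rule: less_induct)
  case less
  have c: "t \<otimes> (s \<otimes> (t \<otimes> y)) = s \<otimes> (t \<otimes> (s \<otimes> y))" if "y \<in> carrier W" for y
    using braid3[of s t] assms that by (simp flip: m_assoc)
  have step: ?case if rst: "r \<in> {s, t}" "len (r \<otimes> x) < len x" for r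
  proof -
    have r: "r \<in> S" using rst assms by auto
    obtain y where y: "y \<in> carrier W" "len y < len (s \<otimes> y)" "len y < len (t \<otimes> y)"
      "r \<otimes> x \<in> {y, s \<otimes> y, t \<otimes> y, s \<otimes> (t \<otimes> y), t \<otimes> (s \<otimes> y), s \<otimes> (t \<otimes> (s \<otimes> y))}"
      using less(1)[OF rst(2)] r less.prems by auto
    have "x = r \<otimes> (r \<otimes> x)" using r less.prems by simp
    then have "x \<in> (\<otimes>) r ` {y, s \<otimes> y, t \<otimes> y, s \<otimes> (t \<otimes> y), t \<otimes> (s \<otimes> y), s \<otimes> (t \<otimes> (s \<otimes> y))}"
      using y(4) by blast
    then show ?thesis using y(1-3) rst(1) assms c[OF y(1)] c[of "s \<otimes> y"]
      by (intro bexI[of _ y]) auto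
  qed
  show ?case
  proof (cases "len x < len (s \<otimes> x) \<and> len x < len (t \<otimes> x)")
    case True
    then show ?thesis using less.prems by (intro bexI[of _ x]) auto
  next
    case False
    then have "len (s \<otimes> x) < len x \<or> len (t \<otimes> x) < len x"
      using len_cases[of s x] len_cases[of t x] assms less.prems by auto
    then show ?thesis using step by blast
  qed
qed

text \<open>The transpose of left multiplication, where T_s T_x is T_(sx), or q_s T_(sx) + (1 - q_s)
  T_x if s shortens x. Transposition reverses products, but the defining relations are invariant
  under reversal. Outside the carrier the identity is taken because it satisfies all the
  relations.\<close>

definition lam :: "('a \<Rightarrow> 'f::field) \<Rightarrow> 'a \<Rightarrow> ('a \<Rightarrow> 'f) \<Rightarrow> 'a \<Rightarrow> 'f" where
  "lam q s g x = (if x \<notin> carrier W then g x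
     else if len x < len (s \<otimes> x) then g (s \<otimes> x)
     else q s * g (s \<otimes> x) + (1 - q s) * g x)"

lemma linear_op_lam: "linear_op (lam q s)"
  by (auto simp: linear_op_def lam_def algebra_simps fun_eq_iff)

lemma lam_quadratic:
  assumes "s \<in> S"
  shows "lam q s (lam q s g) x = (1 - q s) * lam q s g x + q s * g x"
proof (cases "x \<in> carrier W")
  case True
  then consider "len (s \<otimes> x) = Suc (len x)" | "len x = Suc (len (s \<otimes> x))"
    using assms len_cases by blast
  then show ?thesis using assms True by cases (simp_all add: lam_def algebra_simps)
next
  case False
  then show ?thesis by (simp add: lam_def algebra_simps)
qed

lemma lam_braid2:
  assumes "s \<in> S" "t \<in> S" "s \<noteq> t" "m s t = 2"
  shows "lam q s (lam q t g) x = lam q t (lam q s g) x"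
proof (cases "x \<in> carrier W")
  case True
  then obtain y where y: "y \<in> carrier W" "len y < len (s \<otimes> y)" "len y < len (t \<otimes> y)"
    "x \<in> {y, s \<otimes> y, t \<otimes> y, s \<otimes> (t \<otimes> y)}" using coset2 assms by meson
  have c: "t \<otimes> (s \<otimes> y) = s \<otimes> (t \<otimes> y)"
    using braid2[of s t] assms y by (simp flip: m_assoc)
  have c': "t \<otimes> (s \<otimes> (t \<otimes> y)) = s \<otimes> y" using c assms y by (metis gen_cancel gen_closed m_closed)
  have l: "len (s \<otimes> y) = Suc (len y)" "len (t \<otimes> y) = Suc (len y)"
    "len (s \<otimes> (t \<otimes> y)) = Suc (Suc (len y))"
    using len_cases[of s y] len_cases[of t y] len_second_up[of s t y] assms y by auto
  show ?thesis using y(4) assms y(1)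
    by (elim insertE emptyE) (simp_all add: lam_def l c c' algebra_simps)
next
  case False
  then show ?thesis by (simp add: lam_def)
qed

text \<open>Relative to the minimal y all lengths in the coset are known, so at each of its six
  elements both sides become explicit combinations of values of g. The two sides meet descents of s
  and of t in different places, hence the equal parameters.\<close>

lemma lam_braid3:
  assumes "s \<in> S" "t \<in> S" "s \<noteq> t" "m s t = 3" "q s = q t"
  shows "lam q s (lam q t (lam q s g)) x = lam q t (lam q s (lam q t g)) x"
proof (cases "x \<in> carrier W")
  case True
  then obtain y where y: "y \<in> carrier W" "len y < len (s \<otimes> y)" "len y < len (t \<otimes> y)"
    "x \<in> {y, s \<otimes> y, t \<otimes> y, s \<otimes> (t \<otimes> y), t \<otimes> (s \<otimes> y), s \<otimes> (t \<otimes> (s \<otimes> y))}"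
    using coset3 assms by meson
  have m: "m t s = 3" using matrix_sym assms by metis
  have c: "t \<otimes> (s \<otimes> (t \<otimes> y)) = s \<otimes> (t \<otimes> (s \<otimes> y))"
    using braid3[of s t] assms y by (simp flip: m_assoc)
  have c': "t \<otimes> (s \<otimes> (t \<otimes> (s \<otimes> y))) = s \<otimes> (t \<otimes> y)" using c assms y by (metis gen_cancel gen_closed m_closed)
  have l: "len (s \<otimes> y) = Suc (len y)" "len (t \<otimes> y) = Suc (len y)"
    "len (s \<otimes> (t \<otimes> y)) = Suc (Suc (len y))" "len (t \<otimes> (s \<otimes> y)) = Suc (Suc (len y))"
    "len (s \<otimes> (t \<otimes> (s \<otimes> y))) = Suc (Suc (Suc (len y)))"
    using len_cases[of s y] len_cases[of t y] len_second_up[of s t y] len_second_up[of t s y]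
      len_third_up[of s t y] assms y by auto
  show ?thesis using y(4) assms y(1)
    by (elim insertE emptyE) (simp_all add: lam_def l c c' algebra_simps)
next
  case False
  then show ?thesis by (simp add: lam_def)
qed

text \<open>The outermost operator moves the argument first, so the letters of u arrive one by one
  in front of v. The growing word stays reduced, hence only the length-increasing branch of
  \<open>lam\<close> is taken.\<close>

lemma foldr_lam:
  assumes "reduced (rev u @ v)"
  shows "foldr (lam q) u g (ev v) = g (ev (rev u @ v))"
  using assms
proof (induction u arbitrary: v)
  case (Cons s u)
  have suffix: "reduced b" if "reduced (a @ b)" for a b
    using that by (induction a) (auto dest: reduced_tl)
  have "reduced (s # v)" using Cons.prems suffix[of "rev u" "s # v"] by simp
  then have "len (ev v) < len (s \<otimes> ev v)" "v \<in> lists S"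
    using reduced_Cons_up[of s v] reduced_lists[of "s # v"] by simp_all
  then show ?case using Cons.IH[of "s # v"] Cons.prems by (simp add: lam_def)
qed simp

lemma len_inv: "w \<in> carrier W \<Longrightarrow> len (inv w) = len w"
proof -
  have "len (inv w) \<le> len w" if w: "w \<in> carrier W" for w
  proof -
    obtain u where "reduced u" "ev u = w" using reduced_exists[OF w] by blast
    then show ?thesis using len_le[of "rev u"] by (simp add: reduced_def ev_rev)
  qed
  from this[of w] this[of "inv w"] show "w \<in> carrier W \<Longrightarrow> len (inv w) = len w" by simp
qed

lemma reduced_rev: "reduced u \<Longrightarrow> reduced (rev u)"
  by (simp add: reduced_def ev_rev len_inv)

lemma foldr_lam_one:
  assumes "reduced u" shows "foldr (lam q) u g \<one> = g (inv (ev u))"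
  using foldr_lam[of u "[]" q g] reduced_rev[OF assms] reduced_lists[OF assms] by (simp add: ev_rev)

end


section \<open>Linear independence\<close>

text \<open>Each form detects its own vector and kills all others of the same or higher rank.
  Injectivity comes from the same data, by using the form of the index with the smaller rank; it is
  what makes the result one about a family.\<close>

lemma triangular_independence:
  fixes V :: "('f::field, 'v, 'c) module_scheme" and b :: "'i \<Rightarrow> 'v" and r :: "'i \<Rightarrow> nat"
    and F :: "'i \<Rightarrow> 'v \<Rightarrow> 'f"
  assumes "vectorspace class_ring V" and b: "b ` I \<subseteq> carrier V"
    and add: "\<And>i x y. \<lbrakk>i \<in> I; x \<in> carrier V; y \<in> carrier V\<rbrakk> \<Longrightarrow> F i (x \<oplus>\<^bsub>V\<^esub> y) = F i x + F i y"
    and smult: "\<And>i c x. \<lbrakk>i \<in> I; x \<in> carrier V\<rbrakk> \<Longrightarrow> F i (c \<odot>\<^bsub>V\<^esub> x) = c * F i x"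
    and diag: "\<And>i. i \<in> I \<Longrightarrow> F i (b i) = 1"
    and off: "\<And>i j. \<lbrakk>i \<in> I; j \<in> I; i \<noteq> j; r i \<le> r j\<rbrakk> \<Longrightarrow> F i (b j) = 0"
  shows "inj_on b I" and "\<not> LinearCombinations.module.lin_dep class_ring V (b ` I)"
proof -
  interpret vectorspace class_ring V by fact
  show inj: "inj_on b I"
  proof (rule inj_onI, rule ccontr)
    fix i j assume *: "i \<in> I" "j \<in> I" "b i = b j" "i \<noteq> j"
    then show False
      using off[of i j] off[of j i] diag[of i] diag[of j] by (cases "r i \<le> r j") auto
  qed
  show "\<not> lin_dep (b ` I)"
  proof
    assume "lin_dep (b ` I)"
    then obtain A a v where A: "finite A" "A \<subseteq> b ` I" "lincomb a A = \<zero>\<^bsub>V\<^esub>"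
      "v \<in> A" "a v \<noteq> 0"
      unfolding lin_dep_def by auto
    define idx where "idx = the_inv_into I b"
    have idx: "idx w \<in> I" "b (idx w) = w" if "w \<in> A" for w
      using A(2) inj that unfolding idx_def
      by (auto intro: the_inv_into_into f_the_inv_into_f)
    \<comment> \<open>Among the vectors with nonzero coefficient, one of least rank: its form kills
      every other term of the combination.\<close>
    obtain v0 where v0: "v0 \<in> A" "a v0 \<noteq> 0"
      "\<And>w. w \<in> A \<Longrightarrow> a w \<noteq> 0 \<Longrightarrow> r (idx v0) \<le> r (idx w)"
      using ex_has_least_nat[of "\<lambda>w. w \<in> A \<and> a w \<noteq> 0" v "\<lambda>w. r (idx w)"] A(4,5) by auto
    define i where "i = idx v0"
    have i: "i \<in> I" using idx v0 by (simp add: i_def)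
    have "F i (0 \<odot>\<^bsub>V\<^esub> \<zero>\<^bsub>V\<^esub>) = 0 * F i \<zero>\<^bsub>V\<^esub>" by (rule smult[OF i M.zero_closed])
    moreover have "(0::'f) \<odot>\<^bsub>V\<^esub> \<zero>\<^bsub>V\<^esub> = \<zero>\<^bsub>V\<^esub>" using smult_r_null[of "0::'f"] by simp
    ultimately have zero: "F i \<zero>\<^bsub>V\<^esub> = 0" by simp
    have AV: "A \<subseteq> carrier V" using A(2) b by blast
    have "F i (lincomb a B) = (\<Sum>w\<in>B. a w * F i w)" if "B \<subseteq> A" for B
      using finite_subset[OF that A(1)] that
    proof (induction B rule: finite_induct)
      case empty
      then show ?case by (simp add: lincomb_def zero)
    next
      case (insert w B)
      then have "lincomb a (insert w B) = a w \<odot>\<^bsub>V\<^esub> w \<oplus>\<^bsub>V\<^esub> lincomb a B"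
        using AV unfolding lincomb_def by (intro M.finsum_insert) auto
      moreover have "w \<in> carrier V" "lincomb a B \<in> carrier V" using insert AV by auto
      ultimately show ?case using insert by (simp add: add[OF i] smult[OF i])
    qed
    from this[of A] have "(\<Sum>w\<in>A. a w * F i w) = 0" using A(3) zero by simp
    moreover have "a w * F i w = 0" if "w \<in> A - {v0}" for w
    proof (cases "a w = 0")
      case False
      then have "r i \<le> r (idx w)" using that v0(3) by (auto simp: i_def)
      moreover have "idx w \<noteq> i" using that v0(1) idx(2) unfolding i_def by (metis DiffD1 DiffD2 singletonI)
      ultimately show ?thesis using off[of i "idx w"] i idx that by auto
    qed simp
    ultimately have "a v0 * F i v0 = 0"
      using A(1) v0(1) sum.remove[of A v0 "\<lambda>w. a w * F i w"] by simp
    then show False using v0 diag[OF i] idx(2)[OF v0(1)] by (simp add: i_def)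
  qed
qed

section \<open>Products of parabolic subgroups and modified actions\<close>

context simply_laced_coxeter
begin

lemma reduced_concat:
  assumes "list_all2 (\<lambda>u P. reduced u \<and> set u \<subseteq> P) us Ps" "sorted_wrt (\<lambda>A B. A \<inter> B = {}) Ps"
  shows "reduced (concat us) \<and> set (concat us) \<subseteq> \<Union> (set Ps)"
  using assms
proof (induction rule: list_all2_induct)
  case (Cons u us P Ps)
  then have "set u \<inter> set (concat us) = {}" by fastforce
  then show ?case using Cons reduced_append[of u "concat us"] by auto
qed simp

text \<open>From p x = q y follows that q^-1 p = y x^-1 has words over disjoint sets of letters, so
  it is trivial; thus p = q and x = y. No commutation between the factors enters.\<close>

lemma concat_inj:
  assumes "list_all2 (\<lambda>u P. u \<in> lists S \<and> set u \<subseteq> P) us Ps"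
    "list_all2 (\<lambda>u P. u \<in> lists S \<and> set u \<subseteq> P) vs Ps"
    "sorted_wrt (\<lambda>A B. A \<inter> B = {}) Ps" "ev (concat us) = ev (concat vs)"
  shows "map ev us = map ev vs"
  using assms
proof (induction arbitrary: vs rule: list_all2_induct)
  case (Cons u us P Ps)
  obtain v vs' where v: "vs = v # vs'" "v \<in> lists S" "set v \<subseteq> P"
    "list_all2 (\<lambda>u P. u \<in> lists S \<and> set u \<subseteq> P) vs' Ps"
    using Cons.prems(1) by (auto simp: list_all2_Cons2)
  have sub: "set (concat xs) \<subseteq> \<Union> (set Ps) \<and> concat xs \<in> lists S"
    if "list_all2 (\<lambda>u P. u \<in> lists S \<and> set u \<subseteq> P) xs Ps" for xs
    using that by (induction rule: list_all2_induct) auto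
  note sub = sub[OF Cons.hyps(2)] sub[OF v(4)]
  have disj: "P \<inter> \<Union> (set Ps) = {}" using Cons.prems(2) by auto
  have uv: "u \<in> lists S" "set u \<subseteq> P" using Cons.hyps by auto
  let ?p = "ev u" and ?q = "ev v" and ?x = "ev (concat us)" and ?y = "ev (concat vs')"
  have c: "?p \<in> carrier W" "?q \<in> carrier W" "?x \<in> carrier W" "?y \<in> carrier W"
    using uv v sub by simp_all
  have eq: "?p \<otimes> ?x = ?q \<otimes> ?y"
    using Cons.prems(3) v uv sub by (simp add: ev_append)
  then have "inv ?q \<otimes> ?p \<otimes> ?x = ?y" using c by (simp add: m_assoc) (simp flip: m_assoc)
  then have "inv ?q \<otimes> ?p = ?y \<otimes> inv ?x"
    using c inv_solve_right[of "inv ?q \<otimes> ?p" ?y ?x] by simp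
  then have "ev (rev v @ u) = ev (concat vs' @ rev (concat us))"
    using uv v sub ev_append[of "rev v" u] ev_append[of "concat vs'" "rev (concat us)"]
    by (simp add: ev_rev)
  moreover have "set (rev v @ u) \<inter> set (concat vs' @ rev (concat us)) = {}"
    using uv(2) v(3) sub disj unfolding set_append set_rev by blast
  moreover have "rev v @ u \<in> lists S" "concat vs' @ rev (concat us) \<in> lists S"
    using uv v sub by auto
  ultimately have "ev (rev v @ u) = \<one>" using disjoint_words by blast
  then have "inv ?q \<otimes> ?p = \<one>" using uv v ev_append[of "rev v" u] by (simp add: ev_rev)
  then have pq: "?p = ?q" using c inv_solve_left[of \<one> ?q ?p] by simp
  then have "?x = ?y" using eq c by simp
  then show ?case using Cons.IH[OF v(4)] Cons.prems(2) pq v(1) by simp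
qed simp

definition act_op :: "('a \<Rightarrow> 'f::field) \<Rightarrow> 'a set \<Rightarrow> 'a set \<Rightarrow> 'a \<Rightarrow> ('a \<Rightarrow> 'f) \<Rightarrow> 'a \<Rightarrow> 'f" where
  "act_op q Z D s = (if s \<in> Z then (\<lambda>g x. 0) else if s \<in> D then (\<lambda>g. g) else lam q s)"

text \<open>The zero operator solves the quadratic relation only for parameter 0, the identity
  solves it always. On an edge, a zero operator annihilates both sides; an identity at one end
  leaves idempotence of the other operator, hence parameter 0 there; two copies of
  \<open>lam\<close> need equal parameters.\<close>

lemma hecke_operators_act_op:
  assumes Z: "\<And>s. s \<in> Z \<Longrightarrow> s \<in> S \<Longrightarrow> q s = 0"
    and D: "\<And>s t. \<lbrakk>s \<in> S; t \<in> S; s \<noteq> t; m s t = 3; s \<notin> Z; t \<notin> Z; s \<in> D; t \<notin> D\<rbrakk> \<Longrightarrow> q t = 0"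
    and eq: "\<And>s t. \<lbrakk>s \<in> S; t \<in> S; s \<noteq> t; m s t = 3; s \<notin> Z \<union> D; t \<notin> Z \<union> D\<rbrakk> \<Longrightarrow> q s = q t"
  shows "hecke_operators (act_op q Z D) S m q"
proof
  fix s show lin: "linear_op (act_op q Z D s)"
    using linear_op_lam[of q s] by (auto simp: act_op_def linear_op_def)
next
  fix s g x assume "s \<in> S"
  then show "act_op q Z D s (act_op q Z D s g) x = (1 - q s) * act_op q Z D s g x + q s * g x"
    using Z[of s] lam_quadratic[of s q g x] by (simp add: act_op_def algebra_simps)
next
  fix s t n g x assume st: "s \<in> S" "t \<in> S" "s \<noteq> t" "m s t = enat n"
  have z: "lam q r (\<lambda>x. 0) = (\<lambda>x. 0)" for r
    using linear_op_zero[OF linear_op_lam] .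
  have idem: "lam q r (lam q r h) y = lam q r h y" if "r \<in> S" "q r = 0" for r h y
    using lam_quadratic[OF that(1), of q h y] that(2) by simp
  have sym: "m t s = m s t" using matrix_sym st by simp
  from st m_cases[of s t] consider "n = 2" "m s t = 2" | "n = 3" "m s t = 3"
    by (auto simp: numeral_eq_enat)
  then show "foldr (act_op q Z D) (alternating n s t) g x = foldr (act_op q Z D) (alternating n t s) g x"
  proof cases
    case 1
    then show ?thesis using lam_braid2[OF st(1-3) 1(2)] z[of s] z[of t]
      by (auto simp: act_op_def alternating_two)
  next
    case 2
    consider "s \<in> Z \<or> t \<in> Z" | "s \<notin> Z" "t \<notin> Z" "s \<in> D" "t \<in> D"
      | "s \<notin> Z" "t \<notin> Z" "s \<in> D" "t \<notin> D" | "s \<notin> Z" "t \<notin> Z" "s \<notin> D" "t \<in> D"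
      | "s \<notin> Z \<union> D" "t \<notin> Z \<union> D" by blast
    then show ?thesis
    proof cases
      case a: 1
      then show ?thesis using 2 z[of s] z[of t] by (auto simp: act_op_def alternating_three)
    next
      case a: 2
      then show ?thesis using 2 by (simp add: act_op_def alternating_three)
    next
      case a: 3
      then show ?thesis using 2 D[of s t] st idem[of t g x] by (simp add: act_op_def alternating_three)
    next
      case a: 4
      then show ?thesis using 2 D[of t s] st sym idem[of s g x] by (simp add: act_op_def alternating_three)
    next
      case a: 5
      then show ?thesis using 2 lam_braid3[of s t q g x] eq[of s t] st
        by (simp add: act_op_def alternating_three)
    qed
  qed
qed

end

lemma monomial_mult: "monomial u * monomial v = monomial (u @ v)"
  by (simp add: monomial_def mult_single plus_free_monoid_def)

lemma monomial_Nil: "monomial [] = 1"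
  by (simp add: monomial_def zero_free_monoid_def[symmetric])

abbreviation hecke_word :: "'a set \<Rightarrow> ('a \<Rightarrow> 'a \<Rightarrow> enat) \<Rightarrow> ('a \<Rightarrow> 'f::field) \<Rightarrow> 'a list \<Rightarrow>
    ('a free_monoid \<Rightarrow>\<^sub>0 'f) set" where
  "hecke_word S m q u \<equiv> hecke_class S m q (monomial u)"

lemma hecke_word_closed: "u \<in> lists S \<Longrightarrow> hecke_word S m q u \<in> carrier (hecke_algebra S m q)"
  unfolding carrier_hecke_algebra by (intro imageI monomial_closed)

lemma hecke_word_append:
  "\<lbrakk>u \<in> lists S; v \<in> lists S\<rbrakk> \<Longrightarrow>
    hecke_word S m q u \<otimes>\<^bsub>hecke_algebra S m q\<^esub> hecke_word S m q v = hecke_word S m q (u @ v)"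
  using hecke_class_mult[OF monomial_closed monomial_closed] by (metis monomial_mult)

lemma hecke_word_Nil: "hecke_word S m q [] = \<one>\<^bsub>hecke_algebra S m q\<^esub>"
  by (simp add: hecke_class_one monomial_Nil)

lemma list_prod_hecke_gen:
  "u \<in> lists S \<Longrightarrow> list_prod (hecke_algebra S m q) (map (hecke_gen S m q) u) = hecke_word S m q u"
proof (induction u)
  case (Cons s u)
  then show ?case using hecke_word_append[of "[s]" S u m q]
    by (simp add: hecke_gen_def hecke_class_def)
qed (simp add: hecke_word_Nil)

section \<open>Components of equal parameter and the words of tuples\<close>

locale hecke_parameters = simply_laced_coxeter W S m
  for W :: "('a, 'b) monoid_scheme" (structure) and S m +
  fixes q :: "'a \<Rightarrow> 'f::field" and Ss :: "'a set list"
  assumes collapse: "collapse_free S m q"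
    and Ss_distinct: "distinct Ss"
    and Ss_set: "set Ss = parameter_components S m q"
begin

definition edges :: "('a \<times> 'a) set" where
  "edges = coxeter_diagram S m - {(s, t). q s \<noteq> q t}"

lemma edges_iff: "(s, t) \<in> edges \<longleftrightarrow> s \<in> S \<and> t \<in> S \<and> s \<noteq> t \<and> m s t = 3 \<and> q s = q t"
  using m_cases[of s t] by (auto simp: edges_def coxeter_diagram_def numeral_eq_enat)

lemma sym_edges: "sym (edges\<^sup>*)"
  by (intro sym_rtrancl symI) (auto simp: edges_iff matrix_sym)

lemma edges_rtrancl: "(s, t) \<in> edges\<^sup>* \<Longrightarrow> q s = q t \<and> (s \<in> S \<longleftrightarrow> t \<in> S)"
  by (induction rule: rtrancl_induct) (auto simp: edges_iff)

lemma Ss_components: "set Ss = (\<lambda>s. edges\<^sup>* `` {s}) ` S"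
  by (simp add: Ss_set parameter_components_def edges_def Let_def)

lemma Ss_nth: "\<lbrakk>i < length Ss; s \<in> Ss ! i\<rbrakk> \<Longrightarrow> s \<in> S \<and> Ss ! i = edges\<^sup>* `` {s}"
proof -
  assume i: "i < length Ss" "s \<in> Ss ! i"
  then have "Ss ! i \<in> (\<lambda>s. edges\<^sup>* `` {s}) ` S" using Ss_components nth_mem by blast
  then obtain r where r: "r \<in> S" "Ss ! i = edges\<^sup>* `` {r}" by auto
  then have rs: "(r, s) \<in> edges\<^sup>*" using i by simp
  then have "(s, r) \<in> edges\<^sup>*" using sym_edges by (auto dest: symD)
  then have "edges\<^sup>* `` {r} = edges\<^sup>* `` {s}" using rs by (auto intro: rtrancl_trans)
  then show ?thesis using r rs edges_rtrancl by auto
qed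

lemma Ss_subset: "i < length Ss \<Longrightarrow> Ss ! i \<subseteq> S"
  using Ss_nth by blast

lemma Ss_same: "\<lbrakk>i < length Ss; s \<in> Ss ! i; t \<in> Ss ! i\<rbrakk> \<Longrightarrow> (s, t) \<in> edges\<^sup>* \<and> q s = q t"
  using Ss_nth[of i s] edges_rtrancl[of s t] by auto

lemma Ss_disjoint: "\<lbrakk>i < length Ss; j < length Ss; s \<in> Ss ! i; s \<in> Ss ! j\<rbrakk> \<Longrightarrow> i = j"
  using Ss_nth[of i s] Ss_nth[of j s] Ss_distinct by (simp add: nth_eq_iff_index_eq)

lemma Ss_cover: "s \<in> S \<Longrightarrow> \<exists>i < length Ss. s \<in> Ss ! i"
proof -
  assume "s \<in> S"
  then have "edges\<^sup>* `` {s} \<in> set Ss" unfolding Ss_components by blast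
  then obtain i where "i < length Ss" "Ss ! i = edges\<^sup>* `` {s}" by (auto simp: in_set_conv_nth)
  then show ?thesis by auto
qed

lemma Ss_edge: "\<lbrakk>i < length Ss; s \<in> Ss ! i; t \<in> S; s \<noteq> t; m s t = 3; q s = q t\<rbrakk> \<Longrightarrow> t \<in> Ss ! i"
  using Ss_nth[of i s] edges_iff[of s t] by auto

lemma Ss_sorted: "sorted_wrt (\<lambda>A B. A \<inter> B = {}) Ss"
  unfolding sorted_wrt_iff_nth_less
proof (intro allI impI)
  fix i j assume "i < j" "j < length Ss"
  then show "Ss ! i \<inter> Ss ! j = {}" using Ss_disjoint[of i j] by fastforce
qed

lemma collapseD: "\<lbrakk>s \<in> S; t \<in> S; m s t = 3; q s \<noteq> q t\<rbrakk> \<Longrightarrow> q s = 0 \<or> q t = 0"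
  using collapse unfolding collapse_free_def by (force simp: numeral_eq_enat)

text \<open>The same choice as in \<open>hecke_T\<close>, so that basis elements become classes of
  words by unfolding.\<close>

definition rword :: "'a \<Rightarrow> 'a list" where
  "rword w = (SOME u. reduced_expression W S w u)"

lemma rword: "w \<in> carrier W \<Longrightarrow> reduced (rword w) \<and> ev (rword w) = w"
proof -
  assume "w \<in> carrier W"
  then have "\<exists>u. reduced_expression W S w u"
    using reduced_exists[of w] by (simp add: reduced_expression_iff)
  then have "reduced_expression W S w (rword w)"
    unfolding rword_def by (rule someI_ex)
  then show ?thesis by (simp add: reduced_expression_iff)
qed

lemma rword_one [simp]: "rword \<one> = []"
proof -
  have "reduced (rword \<one>)" "ev (rword \<one>) = \<one>" using rword[of \<one>] by auto
  then have "length (rword \<one>) = 0" unfolding reduced_def by simp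
  then show ?thesis by simp
qed

text \<open>A word over I contains the letters of some reduced word of w, and every reduced word of
  w has the same letters, including the arbitrarily chosen one.\<close>

lemma rword_set:
  assumes "I \<subseteq> S" "w \<in> generate W I"
  shows "w \<in> carrier W" "set (rword w) \<subseteq> I"
proof -
  from assms obtain u where u: "u \<in> lists I" "w = ev u" using generate_words[OF assms(1)] by blast
  then have "u \<in> lists S" using assms(1) by auto
  then show w: "w \<in> carrier W" using u by simp
  obtain v where v: "reduced v" "ev v = ev u" "set v \<subseteq> set u" using reduced_subword[OF \<open>u \<in> lists S\<close>] by blast
  then show "set (rword w) \<subseteq> I" using reduced_set[of "rword w" v] rword[OF w] u by auto
qed

definition tuples :: "'a list set" where
  "tuples = {ws. length ws = length Ss \<and> (\<forall>i < length Ss. ws ! i \<in> generate W (Ss ! i))}"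

lemma basis_index_eq:
  "basis_index W S m q Ss = {ws \<in> tuples. \<forall>i < length Ss. \<forall>j < length Ss.
     dominates W S m q Ss i (ws ! i) j \<longrightarrow> ws ! j = \<one>}"
  by (auto simp: basis_index_def tuples_def)

definition word :: "'a list \<Rightarrow> 'a list" where
  "word ws = concat (map rword ws)"

lemma tuples_rword:
  assumes "ws \<in> tuples" "i < length Ss"
  shows "ws ! i \<in> carrier W" "reduced (rword (ws ! i))" "ev (rword (ws ! i)) = ws ! i"
    "set (rword (ws ! i)) \<subseteq> Ss ! i"
  using assms rword_set[OF Ss_subset, of i "ws ! i"] rword[of "ws ! i"] by (auto simp: tuples_def)

lemma word_reduced: "ws \<in> tuples \<Longrightarrow> reduced (word ws)"
proof -
  assume ws: "ws \<in> tuples"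
  then have "length ws = length Ss" by (simp add: tuples_def)
  then have "list_all2 (\<lambda>u P. reduced u \<and> set u \<subseteq> P) (map rword ws) Ss"
    using tuples_rword(2,4)[OF ws] by (simp add: list_all2_conv_all_nth)
  then show ?thesis unfolding word_def using reduced_concat Ss_sorted by blast
qed

lemma word_inj:
  assumes "ws \<in> tuples" "ws' \<in> tuples" "ev (word ws) = ev (word ws')"
  shows "ws = ws'"
proof -
  have *: "list_all2 (\<lambda>u P. u \<in> lists S \<and> set u \<subseteq> P) (map rword xs) Ss" "map ev (map rword xs) = xs"
    if "xs \<in> tuples" for xs
    using tuples_rword[OF that] reduced_lists that
    by (auto simp: list_all2_conv_all_nth tuples_def intro!: nth_equalityI)
  show ?thesis
    using concat_inj[OF *(1)[OF assms(1)] *(1)[OF assms(2)] Ss_sorted] assms *(2) by (simp add: word_def)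
qed

lemma set_word:
  assumes "ws \<in> tuples" "s \<in> set (word ws)"
  shows "\<exists>i < length Ss. s \<in> set (rword (ws ! i)) \<and> s \<in> Ss ! i"
proof -
  obtain x where x: "x \<in> set ws" "s \<in> set (rword x)"
    using assms(2) by (auto simp: word_def)
  then obtain i where "i < length ws" "s \<in> set (rword (ws ! i))"
    unfolding in_set_conv_nth[of x] by blast
  then show ?thesis using assms(1) tuples_rword(4)[OF assms(1)] by (auto simp: tuples_def)
qed

lemma word_lists: "ws \<in> tuples \<Longrightarrow> word ws \<in> lists S"
  using word_reduced reduced_lists by blast

lemma basis_element_word:
  assumes "ws \<in> tuples" shows "basis_element W S m q ws = hecke_word S m q (word ws)"
proof -
  have "list_prod (hecke_algebra S m q) (map (hecke_T W S m q) xs) = hecke_word S m q (concat (map rword xs))"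
    if "\<forall>x \<in> set xs. rword x \<in> lists S" for xs
    using that
  proof (induction xs)
    case (Cons x xs)
    then have "concat (map rword xs) \<in> lists S" by fastforce
    moreover have "hecke_T W S m q x = hecke_word S m q (rword x)"
      using Cons.prems list_prod_hecke_gen[of "rword x" S m q] by (simp add: hecke_T_def rword_def)
    ultimately show ?case using Cons hecke_word_append[of "rword x" S "concat (map rword xs)" m q] by simp
  qed (simp add: hecke_word_Nil)
  moreover have "\<forall>x \<in> set ws. rword x \<in> lists S"
    using word_lists[OF assms] by (auto simp: word_def)
  ultimately show ?thesis by (simp add: basis_element_def word_def)
qed

section \<open>The action attached to a set of generators of parameter 0\<close>

definition zero_letters :: "'a list \<Rightarrow> 'a set" where
  "zero_letters ws = {s \<in> set (word ws). q s = 0}"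

text \<open>For s in A of parameter 0, the condition \<open>q t \<noteq> 0\<close> excludes the
  component of s itself, which \<open>dominates\<close> excludes by
  \<open>i \<noteq> j\<close>.\<close>

definition dominated :: "'a set \<Rightarrow> 'a set" where
  "dominated A = {t \<in> S. q t \<noteq> 0 \<and> (\<exists>j < length Ss. t \<in> Ss ! j \<and> (\<exists>s \<in> A. \<exists>t' \<in> Ss ! j. m s t' = 3))}"

definition zero_out :: "'a set \<Rightarrow> 'a set" where
  "zero_out A = {s \<in> S. q s = 0} - A"

abbreviation support_op :: "'a set \<Rightarrow> 'a \<Rightarrow> ('a \<Rightarrow> 'f) \<Rightarrow> 'a \<Rightarrow> 'f" where
  "support_op A \<equiv> act_op q (zero_out A) (dominated A)"

lemma dominatedI:
  assumes "s \<in> A" "t \<in> S" "q t \<noteq> 0" "m s t = 3" shows "t \<in> dominated A"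
  using Ss_cover[OF assms(2)] assms by (auto simp: dominated_def)

text \<open>An edge leaving a dominated component changes the parameter, so collapse-freeness puts
  parameter 0 at the far end. An edge with distinct parameters has an end of parameter 0: outside A
  it acts as zero, inside A it dominates the other end. Hence wherever \<open>lam\<close> acts at
  both ends the parameters agree.\<close>

lemma hecke_operators_support:
  assumes A: "A \<subseteq> S" "\<forall>s \<in> A. q s = 0"
  shows "hecke_operators (support_op A) S m q"
proof (rule hecke_operators_act_op)
  show "q s = 0" if "s \<in> zero_out A" for s using that by (simp add: zero_out_def)
next
  fix s t assume st: "s \<in> S" "t \<in> S" "s \<noteq> t" "m s t = 3" "s \<notin> zero_out A" "t \<notin> zero_out A"
    "s \<in> dominated A" "t \<notin> dominated A"
  show "q t = 0"
  proof (rule ccontr)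
    assume "q t \<noteq> 0"
    moreover have "q s \<noteq> 0" using st by (simp add: dominated_def)
    ultimately have "q s = q t" using collapseD st by blast
    then show False using st Ss_edge[of _ s t] \<open>q t \<noteq> 0\<close> by (auto simp: dominated_def)
  qed
next
  fix s t assume st: "s \<in> S" "t \<in> S" "s \<noteq> t" "m s t = 3" "s \<notin> zero_out A \<union> dominated A"
    "t \<notin> zero_out A \<union> dominated A"
  have ts: "m t s = 3" using st matrix_sym by metis
  show "q s = q t"
  proof (rule ccontr)
    assume ne: "q s \<noteq> q t"
    then consider "q s = 0" "q t \<noteq> 0" | "q t = 0" "q s \<noteq> 0" using collapseD st by metis
    then show False
    proof cases
      case 1
      then have "s \<in> A" using st by (auto simp: zero_out_def)
      then show ?thesis using dominatedI[of s A t] st 1 by auto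
    next
      case 2
      then have "t \<in> A" using st by (auto simp: zero_out_def)
      then show ?thesis using dominatedI[of t A s] st 2 ts by auto
    qed
  qed
qed

lemma zero_letters_subset: "ws \<in> tuples \<Longrightarrow> zero_letters ws \<subseteq> S"
  using word_lists by (auto simp: zero_letters_def)

text \<open>A component dominated by a letter of parameter 0 has entry 1 and contributes no letters,
  and \<open>zero_out A\<close> misses the word by the choice of A. So every operator that occurs is
  \<open>lam\<close>, and the word is reduced.\<close>

lemma support_op_same:
  assumes ws: "ws \<in> basis_index W S m q Ss" and A: "zero_letters ws = A"
  shows "foldr (support_op A) (word ws) g \<one> = g (inv (ev (word ws)))"
proof -
  have t: "ws \<in> tuples" using ws by (simp add: basis_index_eq)
  have "support_op A s = lam q s" if s: "s \<in> set (word ws)" for s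
  proof -
    have "s \<notin> zero_out A" using s A by (auto simp: zero_out_def zero_letters_def)
    moreover have "s \<notin> dominated A"
    proof
      assume "s \<in> dominated A"
      then obtain j a t' where j: "q s \<noteq> 0" "j < length Ss" "s \<in> Ss ! j" "a \<in> A" "t' \<in> Ss ! j" "m a t' = 3"
        by (auto simp: dominated_def)
      then have a: "q a = 0" "a \<in> set (word ws)" using A by (auto simp: zero_letters_def)
      obtain i where i: "i < length Ss" "a \<in> set (rword (ws ! i))" "a \<in> Ss ! i"
        using set_word[OF t a(2)] by blast
      \<comment> \<open>The parameter is constant on a component, and it is 0 at a but not at
        s.\<close>
      have "i \<noteq> j" using Ss_same[of i a s] i j a by auto
      moreover have "reduced_expression W S (ws ! i) (rword (ws ! i))"
        unfolding reduced_expression_iff using tuples_rword(2,3)[OF t i(1)] by (rule conjI)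
      ultimately have "dominates W S m q Ss i (ws ! i) j"
        unfolding dominates_def using i(2,3) j(5,6) a(1) by metis
      then have "ws ! j = \<one>" using ws i(1) j(2) unfolding basis_index_eq by blast
      moreover obtain l where l: "l < length Ss" "s \<in> set (rword (ws ! l))" "s \<in> Ss ! l"
        using set_word[OF t s] by blast
      moreover have "l = j" using Ss_disjoint l j by blast
      ultimately show False by simp
    qed
    ultimately show ?thesis by (simp add: act_op_def)
  qed
  then have "foldr (support_op A) (word ws) g = foldr (lam q) (word ws) g"
    by (intro foldr_cong) auto
  then show ?thesis using foldr_lam_one[OF word_reduced[OF t]] by simp
qed

lemma support_op_other:
  assumes ws: "ws \<in> tuples" and A: "\<not> zero_letters ws \<subseteq> A" "A \<subseteq> S" "\<forall>s \<in> A. q s = 0"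
  shows "foldr (support_op A) (word ws) g x = 0"
proof -
  interpret hecke_operators "support_op A" S m q by (rule hecke_operators_support[OF A(2,3)])
  obtain s where s: "s \<in> set (word ws)" "s \<in> zero_out A"
    using A zero_letters_subset[OF ws] by (auto simp: zero_out_def zero_letters_def)
  then obtain u v where "word ws = u @ s # v" by (meson split_list)
  moreover have "support_op A s = (\<lambda>g x. 0)" using s by (simp add: act_op_def)
  moreover have "foldr (support_op A) u (\<lambda>x. 0) = (\<lambda>x. 0)"
    using linear_op_zero[OF linear_op_foldr[OF linear]] .
  ultimately show ?thesis by simp
qed

text \<open>The delta function sits at the inverse because the transposed action of a reduced word,
  evaluated at 1, reads the function there.\<close>

definition coordinate :: "'a list \<Rightarrow> ('a free_monoid \<Rightarrow>\<^sub>0 'f) set \<Rightarrow> 'f" where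
  "coordinate ws = hecke_operators.hecke_form (support_op (zero_letters ws)) S m q
     (\<lambda>x. if x = inv (ev (word ws)) then 1 else 0) \<one>"

lemma independence:
  "inj_on (basis_element W S m q) (basis_index W S m q Ss)"
  "\<not> LinearCombinations.module.lin_dep class_ring (hecke_algebra S m q)
     (basis_element W S m q ` basis_index W S m q Ss)"
proof -
  let ?I = "basis_index W S m q Ss" and ?H = "hecke_algebra S m q"
  have tup: "ws \<in> tuples" if "ws \<in> ?I" for ws using that by (simp add: basis_index_eq)
  have ops: "hecke_operators (support_op (zero_letters ws)) S m q" if "ws \<in> tuples" for ws
    using hecke_operators_support[OF zero_letters_subset[OF that]] by (simp add: zero_letters_def)
  have coord: "coordinate ws (basis_element W S m q ws') =
      foldr (support_op (zero_letters ws)) (word ws') (\<lambda>x. if x = inv (ev (word ws)) then 1 else 0) \<one>"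
    if "ws \<in> tuples" "ws' \<in> tuples" for ws ws'
  proof -
    interpret hecke_operators "support_op (zero_letters ws)" S m q by (rule ops[OF that(1)])
    show ?thesis unfolding coordinate_def basis_element_word[OF that(2)]
      using hecke_form_class[OF monomial_closed[OF word_lists[OF that(2)]]] by (simp only: rep_monomial)
  qed
  have b: "basis_element W S m q ` ?I \<subseteq> carrier ?H"
    using tup basis_element_word hecke_word_closed word_lists by fastforce
  have add: "coordinate ws (x \<oplus>\<^bsub>?H\<^esub> y) = coordinate ws x + coordinate ws y"
    if "ws \<in> ?I" "x \<in> carrier ?H" "y \<in> carrier ?H" for ws x y
    unfolding coordinate_def by (rule hecke_operators.hecke_form_add[OF ops[OF tup[OF that(1)]] that(2,3)])
  have smult: "coordinate ws (c \<odot>\<^bsub>?H\<^esub> x) = c * coordinate ws x"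
    if "ws \<in> ?I" "x \<in> carrier ?H" for ws c x
    unfolding coordinate_def by (rule hecke_operators.hecke_form_smult[OF ops[OF tup[OF that(1)]] that(2)])
  have diag: "coordinate ws (basis_element W S m q ws) = 1" if "ws \<in> ?I" for ws
    using coord tup that support_op_same[OF that HOL.refl] by simp
  have off: "coordinate ws (basis_element W S m q ws') = 0"
    if ws: "ws \<in> ?I" "ws' \<in> ?I" "ws \<noteq> ws'" "card (zero_letters ws) \<le> card (zero_letters ws')" for ws ws'
  proof (cases "zero_letters ws' \<subseteq> zero_letters ws")
    case True
    \<comment> \<open>Inclusion and the bound on cardinalities force equality. Both words then meet
      the same action and are separated by their elements of W.\<close>
    then have "zero_letters ws' = zero_letters ws"
      using ws(4) by (intro card_seteq) (auto simp: zero_letters_def)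
    moreover have "ev (word ws') \<noteq> ev (word ws)" using word_inj ws tup by metis
    then have "inv (ev (word ws')) \<noteq> inv (ev (word ws))"
      using word_lists tup ws by (metis ev_closed inv_inv)
    ultimately show ?thesis using coord support_op_same[OF ws(2)] tup ws by simp
  next
    case False
    have "\<forall>s \<in> zero_letters ws. q s = 0" by (simp add: zero_letters_def)
    then show ?thesis
      using coord[OF tup[OF ws(1)] tup[OF ws(2)]] False
        support_op_other[OF tup[OF ws(2)] False zero_letters_subset[OF tup[OF ws(1)]]] by simp
  qed
  show "inj_on (basis_element W S m q) ?I"
    and "\<not> LinearCombinations.module.lin_dep class_ring ?H (basis_element W S m q ` ?I)"
    using triangular_independence[where F = coordinate and r = "\<lambda>ws. card (zero_letters ws)",
        OF vectorspace_hecke_algebra b add smult diag off] by blast+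
qed

end


section \<open>Spanning\<close>

text \<open>A scalar sits on the empty word, and coefficients commute. Since scalar multiplication
  is multiplication from the left, centrality is what moves scalars past words.\<close>

lemma scalar_commute: "scalar c * p = p * scalar c"
proof (induction p rule: poly_mapping_induct_single)
  case (single w d)
  then show ?case by (simp add: scalar_def mult_single mult.commute)
qed (auto simp: algebra_simps)

context hecke_parameters
begin

abbreviation H :: "('f, ('a free_monoid \<Rightarrow>\<^sub>0 'f) set) module" where
  "H \<equiv> hecke_algebra S m q"

abbreviation hw :: "'a list \<Rightarrow> ('a free_monoid \<Rightarrow>\<^sub>0 'f) set" where
  "hw \<equiv> hecke_word S m q"

interpretation H: ring H by (rule ring_hecke_algebra)
interpretation H: vectorspace class_ring H by (rule vectorspace_hecke_algebra)

lemma relators_in_ideal: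
  assumes "p \<in> hecke_relators S m q" "u \<in> lists S" "v \<in> lists S"
  shows "monomial u * p * monomial v \<in> hecke_ideal S m q"
proof -
  interpret I: ideal "hecke_ideal S m q" "free_algebra S" by (rule ideal_hecke_ideal)
  have "p \<in> hecke_ideal S m q"
    using ring.genideal_self[OF ring_free_algebra hecke_relators_closed] assms(1)
    unfolding hecke_ideal_def by blast
  then have "monomial u * p \<in> hecke_ideal S m q"
    using I.I_l_closed[OF _ monomial_closed[OF assms(2)]] by simp
  then show ?thesis using I.I_r_closed[OF _ monomial_closed[OF assms(3)]] by simp
qed

lemma hw_closed [simp]: "u \<in> lists S \<Longrightarrow> hw u \<in> carrier H"
  by (rule hecke_word_closed)

lemma hw_append: "\<lbrakk>u \<in> lists S; v \<in> lists S\<rbrakk> \<Longrightarrow> hw (u @ v) = hw u \<otimes>\<^bsub>H\<^esub> hw v"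
  using hecke_word_append by metis

text \<open>The rewriting rule behind the word calculations: a factor may be replaced by one with
  the same class.\<close>

lemma hw_cong:
  assumes "hw a = hw b" "a \<in> lists S" "b \<in> lists S" "u \<in> lists S" "v \<in> lists S"
  shows "hw (u @ a @ v) = hw (u @ b @ v)"
proof -
  have "a @ v \<in> lists S" "b @ v \<in> lists S" using assms by simp_all
  then show ?thesis using assms(1) by (simp only: hw_append assms(2-5))
qed

lemma hw_quadratic:
  assumes "s \<in> S" "u \<in> lists S" "v \<in> lists S"
  shows "hw (u @ [s, s] @ v) =
    ((1 - q s) \<odot>\<^bsub>H\<^esub> hw (u @ [s] @ v)) \<oplus>\<^bsub>H\<^esub> (q s \<odot>\<^bsub>H\<^esub> hw (u @ v))"
proof -
  let ?M = "\<lambda>w. monomial w :: 'a free_monoid \<Rightarrow>\<^sub>0 'f"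
  let ?r = "scalar (1 - q s) * ?M (u @ [s] @ v) + scalar (q s) * ?M (u @ v)"
  let ?p = "(?M [s] - 1) * (?M [s] + scalar (q s))"
  have L: "u @ [s, s] @ v \<in> lists S" "u @ [s] @ v \<in> lists S" "u @ v \<in> lists S"
    using assms by simp_all
  note M = L[THEN monomial_closed]
  note sM = free_algebra_mult_closed[OF scalar_closed M(2)] free_algebra_mult_closed[OF scalar_closed M(3)]
  have "?p \<in> hecke_relators S m q" using assms by (auto simp: hecke_relators_def)
  then have "?M u * ?p * ?M v \<in> hecke_ideal S m q" using relators_in_ideal assms by blast
  moreover have "?M u * ?p * ?M v = ?M (u @ [s, s] @ v) - ?r"
  proof -
    have "(scalar (1 - q s) :: 'a free_monoid \<Rightarrow>\<^sub>0 'f) = 1 - scalar (q s)"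
      using scalar_add[of "1 - q s" "q s"] by (simp add: scalar_one eq_diff_eq)
    then have r: "?r = ?M (u @ [s] @ v) - scalar (q s) * ?M (u @ [s] @ v) + scalar (q s) * ?M (u @ v)"
      by (simp add: left_diff_distrib)
    have "?M (u @ [s, s] @ v) = ?M u * (?M [s] * ?M [s]) * ?M v"
      "?M (u @ [s] @ v) = ?M u * ?M [s] * ?M v" "?M (u @ v) = ?M u * ?M v"
      by (simp_all add: monomial_mult)
    moreover have "scalar (q s) * (?M w * x) = ?M w * (scalar (q s) * x)" for w x
      using scalar_commute[of "q s" "?M w"] by (metis mult.assoc)
    ultimately show ?thesis
      unfolding r using scalar_commute[of "q s" "?M [s]"] by (simp add: algebra_simps)
  qed
  ultimately have "?M (u @ [s, s] @ v) - ?r \<in> hecke_ideal S m q" by simp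
  then have "hw (u @ [s, s] @ v) = hecke_class S m q ?r"
    using hecke_class_eq_iff[OF M(1) free_algebra_add_closed[OF sM]] by blast
  then show ?thesis
    by (simp only: hecke_class_smult[OF M(2)] hecke_class_smult[OF M(3)] hecke_class_add[OF sM])
qed

lemma hw_braid:
  assumes "s \<in> S" "t \<in> S" "s \<noteq> t" "m s t = enat n" "u \<in> lists S" "v \<in> lists S"
  shows "hw (u @ alternating n s t @ v) = hw (u @ alternating n t s @ v)"
proof -
  let ?M = "\<lambda>w. monomial w :: 'a free_monoid \<Rightarrow>\<^sub>0 'f"
  have L: "u @ alternating n s t @ v \<in> lists S" "u @ alternating n t s @ v \<in> lists S"
    using assms by (auto dest!: alternating_subset)
  have "?M (alternating n s t) - ?M (alternating n t s) \<in> hecke_relators S m q"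
    using assms unfolding hecke_relators_def by blast
  then have "?M u * (?M (alternating n s t) - ?M (alternating n t s)) * ?M v \<in> hecke_ideal S m q"
    using relators_in_ideal assms by blast
  then have "?M (u @ alternating n s t @ v) - ?M (u @ alternating n t s @ v) \<in> hecke_ideal S m q"
    by (simp add: algebra_simps monomial_mult)
  then show ?thesis
    using hecke_class_eq_iff[OF L[THEN monomial_closed]] by blast
qed

lemma hw_braid2:
  "\<lbrakk>s \<in> S; t \<in> S; s \<noteq> t; m s t = 2\<rbrakk> \<Longrightarrow> hw [s, t] = hw [t, s]"
  using hw_braid[of s t 2 "[]" "[]"] by (simp add: alternating_two numeral_eq_enat)

lemma hw_braid3:
  "\<lbrakk>s \<in> S; t \<in> S; s \<noteq> t; m s t = 3\<rbrakk> \<Longrightarrow> hw [s, t, s] = hw [t, s, t]"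
  using hw_braid[of s t 3 "[]" "[]"] by (simp add: alternating_three numeral_eq_enat)

lemma hw_braid_equiv: "braid_equiv u v \<Longrightarrow> u \<in> lists S \<Longrightarrow> hw u = hw v"
proof (induction rule: braid_equiv.induct)
  case (trans u v w)
  then show ?case using braid_equiv_set[OF trans.hyps(1)] by (simp add: in_lists_conv_set)
next
  case (Cons u v s)
  then have "u \<in> lists S" "v \<in> lists S"
    using braid_equiv_set[OF Cons.hyps(1)] by (simp_all add: in_lists_conv_set)
  then show ?case using Cons hw_cong[of u v "[s]" "[]"] by simp
next
  case (braid s t n u)
  then show ?case using hw_braid[of s t n "[]" u] by simp
qed simp

text \<open>Braid moves preserve the class, and Matsumoto's theorem connects reduced words by braid
  moves alone.\<close>

lemma hw_reduced: "\<lbrakk>reduced u; reduced v; ev u = ev v\<rbrakk> \<Longrightarrow> hw u = hw v"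
  using hw_braid_equiv matsumoto reduced_lists by blast

section \<open>Absorption and commutation between components\<close>

lemma idempotent:
  assumes "s \<in> S" "q s = 0" shows "hw [s, s] = hw [s]"
  using hw_quadratic[of s "[]" "[]"] assms H.smult_l_null[of "hw []"] H.smult_one[of "hw [s]"]
  by (simp add: class_ring_simps)

lemma add_smult_cancel:
  assumes "x \<in> carrier H" "y \<in> carrier H" "z \<in> carrier H" "c \<noteq> (0 :: 'f)"
    "z \<oplus>\<^bsub>H\<^esub> (c \<odot>\<^bsub>H\<^esub> x) = z \<oplus>\<^bsub>H\<^esub> (c \<odot>\<^bsub>H\<^esub> y)"
  shows "x = y"
proof -
  have "c \<odot>\<^bsub>H\<^esub> x = c \<odot>\<^bsub>H\<^esub> y" using assms by simp
  then have "inverse c \<odot>\<^bsub>H\<^esub> (c \<odot>\<^bsub>H\<^esub> x) = inverse c \<odot>\<^bsub>H\<^esub> (c \<odot>\<^bsub>H\<^esub> y)" by simp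
  then show ?thesis
    using assms H.smult_assoc1[of "inverse c" c x] H.smult_assoc1[of "inverse c" c y]
      H.smult_one[of x] H.smult_one[of y]
    by (simp add: class_ring_simps)
qed

text \<open>T_t is invertible for nonzero parameter. Instead of naming its inverse, the equation is
  multiplied by T_t once more: the quadratic relation then leaves q_t times the shorter words, since
  the terms ending in t agree already.\<close>

lemma right_cancel_gen:
  assumes "t \<in> S" "q t \<noteq> 0" "u \<in> lists S" "v \<in> lists S" "hw (u @ [t]) = hw (v @ [t])"
  shows "hw u = hw v"
proof -
  have "hw (u @ [t, t]) = hw (v @ [t, t])"
    using hw_cong[OF assms(5), of "[]" "[t]"] assms(1,3,4) by simp
  then have "((1 - q t) \<odot>\<^bsub>H\<^esub> hw (u @ [t])) \<oplus>\<^bsub>H\<^esub> (q t \<odot>\<^bsub>H\<^esub> hw u) =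
      ((1 - q t) \<odot>\<^bsub>H\<^esub> hw (u @ [t])) \<oplus>\<^bsub>H\<^esub> (q t \<odot>\<^bsub>H\<^esub> hw v)"
    using hw_quadratic[of t u "[]"] hw_quadratic[of t v "[]"] assms by simp
  from add_smult_cancel[OF _ _ _ assms(2) this] show ?thesis
    using assms(1,3,4) by (simp add: class_ring_simps)
qed

lemma left_cancel_gen:
  assumes "t \<in> S" "q t \<noteq> 0" "u \<in> lists S" "v \<in> lists S" "hw (t # u) = hw (t # v)"
  shows "hw u = hw v"
proof -
  have "hw (t # t # u) = hw (t # t # v)"
    using hw_cong[OF assms(5), of "[t]" "[]"] assms(1,3,4) by simp
  then have "((1 - q t) \<odot>\<^bsub>H\<^esub> hw (t # u)) \<oplus>\<^bsub>H\<^esub> (q t \<odot>\<^bsub>H\<^esub> hw u) =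
      ((1 - q t) \<odot>\<^bsub>H\<^esub> hw (t # u)) \<oplus>\<^bsub>H\<^esub> (q t \<odot>\<^bsub>H\<^esub> hw v)"
    using hw_quadratic[of t "[]" u] hw_quadratic[of t "[]" v] assms by simp
  from add_smult_cancel[OF _ _ _ assms(2) this] show ?thesis
    using assms(1,3,4) by (simp add: class_ring_simps)
qed

definition absorbs :: "'a \<Rightarrow> 'a \<Rightarrow> bool" where
  "absorbs s t \<longleftrightarrow> hw [s, t] = hw [s] \<and> hw [t, s] = hw [s]"

text \<open>Idempotence of T_s and the braid relation give tsts = sts = stst. Cancelling the
  invertible T_t in stst = tst and in tst = tsts yields sts = ts and st = sts. Hence stt = st and
  tts = ts, and a last cancellation leaves st = s and ts = s.\<close>

lemma absorbs_adjacent: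
  assumes "s \<in> S" "t \<in> S" "m s t = 3" "q s = 0" "q t \<noteq> 0"
  shows "absorbs s t"
proof -
  have st: "s \<noteq> t" using assms by auto
  have B: "hw [s, t, s] = hw [t, s, t]" using hw_braid3 assms st by blast
  have I: "hw [s, s] = hw [s]" using idempotent assms by blast
  have 1: "hw [t, s, t, s] = hw [s, t, s]"
    using hw_cong[OF B, of "[]" "[s]"] hw_cong[OF I, of "[s, t]" "[]"] assms by simp
  have 2: "hw [s, t, s, t] = hw [s, t, s]"
    using hw_cong[OF B, of "[s]" "[]"] hw_cong[OF I, of "[]" "[t, s]"] assms by simp
  have 3: "hw [s, t, s] = hw [t, s]"
    using right_cancel_gen[of t "[s, t, s]" "[t, s]"] B 2 assms by simp
  have 4: "hw [s, t] = hw [s, t, s]"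
    using left_cancel_gen[of t "[s, t]" "[s, t, s]"] B 1 assms by simp
  have "hw [s, t, t] = hw [s, t]"
    using hw_cong[OF 4, of "[]" "[t]"] 2 4 assms by simp
  then have "hw [s, t] = hw [s]" using right_cancel_gen[of t "[s, t]" "[s]"] assms by simp
  moreover have "hw [t, t, s] = hw [t, s]"
    using hw_cong[OF 3, of "[t]" "[]"] 1 3 assms by simp
  then have "hw [t, s] = hw [s]" using left_cancel_gen[of t "[t, s]" "[s]"] assms by simp
  ultimately show ?thesis by (simp add: absorbs_def)
qed

text \<open>
  If \<open>T\<^sub>s\<close> absorbs \<open>T\<^sub>b\<close> and commutes with \<open>T\<^sub>c\<close>, multiplying \<open>T\<^sub>bT\<^sub>cT\<^sub>b = T\<^sub>cT\<^sub>bT\<^sub>c\<close> by \<open>T\<^sub>s\<close>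
  gives \<open>T\<^sub>sT\<^sub>c = T\<^sub>sT\<^sub>c\<^sup>2\<close>, and the invertible \<open>T\<^sub>c\<close> cancels.
\<close>

lemma absorbs_edge:
  assumes "s \<in> S" "q s = 0" "absorbs s b" "(b, c) \<in> edges" "q b \<noteq> 0"
  shows "absorbs s c"
proof -
  have bc: "b \<in> S" "c \<in> S" "b \<noteq> c" "m b c = 3" "q b = q c" using assms(4) by (auto simp: edges_iff)
  have sc: "s \<noteq> c" using assms bc by auto
  then consider "m s c = 3" | "m s c = 2" using m_cases[of s c] assms bc by blast
  then show ?thesis
  proof cases
    case 1
    then show ?thesis using absorbs_adjacent[of s c] assms bc by simp
  next
    case 2
    have C: "hw [s, c] = hw [c, s]" using hw_braid2 assms bc sc 2 by blast
    have B: "hw [b, c, b] = hw [c, b, c]" using hw_braid3 bc by blast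
    have A: "hw [s, b] = hw [s]" "hw [b, s] = hw [s]" using assms by (auto simp: absorbs_def)
    have "hw [s, b, c, b] = hw [s, c, b]"
      using hw_cong[OF A(1), of "[]" "[c, b]"] assms bc by simp
    also have "\<dots> = hw [c, s, b]" using hw_cong[OF C, of "[]" "[b]"] assms bc by simp
    also have "\<dots> = hw [c, s]" using hw_cong[OF A(1), of "[c]" "[]"] assms bc by simp
    also have "\<dots> = hw [s, c]" using C by simp
    finally have 1: "hw [s, b, c, b] = hw [s, c]" .
    have "hw [s, c, b, c] = hw [c, s, b, c]"
      using hw_cong[OF C, of "[]" "[b, c]"] assms bc by simp
    also have "\<dots> = hw [c, s, c]" using hw_cong[OF A(1), of "[c]" "[c]"] assms bc by simp
    also have "\<dots> = hw [s, c, c]" using hw_cong[OF C, of "[]" "[c]"] assms bc by simp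
    finally have 2: "hw [s, c, b, c] = hw [s, c, c]" .
    have "hw [s, b, c, b] = hw [s, c, b, c]"
      using hw_cong[OF B, of "[s]" "[]"] assms bc by simp
    then have "hw [s, c, c] = hw [s, c]" using 1 2 by simp
    then have "hw [s, c] = hw [s]" using right_cancel_gen[of c "[s, c]" "[s]"] assms bc by simp
    then show ?thesis using C by (simp add: absorbs_def)
  qed
qed

text \<open>Absorption spreads along a path in the component, on which the parameter keeps its
  nonzero value.\<close>

lemma absorbs_component:
  assumes "s \<in> S" "q s = 0" "m s t = 3" "q t \<noteq> 0" "j < length Ss" "t \<in> Ss ! j" "t' \<in> Ss ! j"
  shows "absorbs s t'"
proof -
  have tS: "t \<in> S" using assms Ss_subset by blast
  have "(t, t') \<in> edges\<^sup>*" using Ss_same assms by blast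
  then show ?thesis
  proof (induction rule: rtrancl_induct)
    case base
    then show ?case using absorbs_adjacent assms tS by blast
  next
    case (step b c)
    then show ?case using absorbs_edge[of s b c] assms edges_rtrancl[OF step.hyps(1)] by simp
  qed
qed

text \<open>An edge between two components joins parameter 0 to a nonzero parameter, and absorption
  then makes both products equal to the generator of parameter 0.\<close>

lemma hw_commute:
  assumes "i < length Ss" "j < length Ss" "i \<noteq> j" "s \<in> Ss ! i" "t \<in> Ss ! j"
  shows "hw [s, t] = hw [t, s]"
proof -
  have st: "s \<in> S" "t \<in> S" "s \<noteq> t" using assms Ss_subset Ss_disjoint by blast+
  then consider "m s t = 2" | "m s t = 3" using m_cases by blast
  then show ?thesis
  proof cases
    case 1
    then show ?thesis using hw_braid2 st by blast
  next
    case 2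
    then have "q s \<noteq> q t" using Ss_edge[of i s t] Ss_disjoint[of i j t] assms st by blast
    then consider "q s = 0" "q t \<noteq> 0" | "q t = 0" "q s \<noteq> 0" using collapseD[of s t] st 2 by metis
    then show ?thesis
    proof cases
      case 1
      then show ?thesis using absorbs_adjacent[of s t] st 2 by (simp add: absorbs_def)
    next
      case a: 2
      then show ?thesis using absorbs_adjacent[of t s] st 2 matrix_sym[of s t] by (simp add: absorbs_def)
    qed
  qed
qed

lemma hw_commute_gen:
  assumes "s \<in> S" "u \<in> lists S" "\<And>t. t \<in> set u \<Longrightarrow> hw [s, t] = hw [t, s]"
  shows "hw (s # u) = hw (u @ [s])"
  using assms(2,3)
proof (induction u)
  case (Cons t u)
  then have t: "t \<in> S" "u \<in> lists S" by auto
  have "hw (s # t # u) = hw (t # s # u)"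
    using hw_cong[of "[s, t]" "[t, s]" "[]" u] Cons.prems assms(1) t by simp
  also have "\<dots> = hw (t # u @ [s])"
    using hw_cong[of "s # u" "u @ [s]" "[t]" "[]"] Cons assms(1) t by simp
  finally show ?case by simp
qed simp

lemma hw_commute_words:
  assumes "u \<in> lists S" "v \<in> lists S" "\<And>s t. s \<in> set u \<Longrightarrow> t \<in> set v \<Longrightarrow> hw [s, t] = hw [t, s]"
  shows "hw (u @ v) = hw (v @ u)"
  using assms(1,3)
proof (induction u)
  case (Cons s u)
  then have s: "s \<in> S" "u \<in> lists S" by auto
  have "hw (u @ v) = hw (v @ u)"
  proof (rule Cons.IH)
    fix a t assume "a \<in> set u" "t \<in> set v"
    then show "hw [a, t] = hw [t, a]" by (intro Cons.prems) simp_all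
  qed
  then have "hw (s # u @ v) = hw (s # v @ u)"
    using hw_cong[of "u @ v" "v @ u" "[s]" "[]"] s assms(2) by simp
  also have "\<dots> = hw (v @ s # u)"
    using hw_cong[of "s # v" "v @ [s]" "[]" u] hw_commute_gen[of s v] Cons.prems s assms(2) by simp
  finally show ?case by simp
qed simp

lemma absorb_word:
  assumes "s \<in> S" "u \<in> lists S" "\<And>t. t \<in> set u \<Longrightarrow> absorbs s t"
  shows "hw (s # u) = hw [s]" "hw (u @ [s]) = hw [s]"
proof -
  show "hw (s # u) = hw [s]"
    using assms(2,3)
  proof (induction u)
    case (Cons t u)
    then show ?case using hw_cong[of "[s, t]" "[s]" "[]" u] assms(1) by (simp add: absorbs_def)
  qed simp
  show "hw (u @ [s]) = hw [s]"
    using assms(2,3)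
  proof (induction u)
    case (Cons t u)
    then show ?case
      using hw_cong[of "u @ [s]" "[s]" "[t]" "[]"] assms(1) by (simp add: absorbs_def)
  qed simp
qed

text \<open>The word u commutes with every letter of v, so it can be moved next to an occurrence of
  s, which swallows it.\<close>

lemma drop_absorbed:
  assumes "s \<in> set v" "u \<in> lists S" "v \<in> lists S" "\<And>t. t \<in> set u \<Longrightarrow> absorbs s t"
    "\<And>r t. r \<in> set v \<Longrightarrow> t \<in> set u \<Longrightarrow> hw [r, t] = hw [t, r]"
  shows "hw (u @ v) = hw v" "hw (v @ u) = hw v"
proof -
  obtain a b where v: "v = a @ s # b" using assms(1) by (meson split_list)
  have S: "s \<in> S" "a \<in> lists S" "b \<in> lists S" using assms(3) v by auto
  have "hw (u @ a) = hw (a @ u)" using hw_commute_words[of u a] assms v S by simp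
  then have "hw (u @ v) = hw (a @ u @ [s] @ b)"
    using hw_cong[of "u @ a" "a @ u" "[]" "s # b"] S assms(2) v by simp
  also have "\<dots> = hw v"
    using hw_cong[of "u @ [s]" "[s]" a b] absorb_word(2)[of s u] S assms(2,4) v by simp
  finally show 1: "hw (u @ v) = hw v" .
  have "hw (v @ u) = hw (u @ v)"
    using assms by (intro hw_commute_words)
  then show "hw (v @ u) = hw v" using 1 by simp
qed

section \<open>Left multiplication on tuples and removal of dominated entries\<close>

lemma word_update:
  assumes "ws \<in> tuples" "i < length Ss"
  shows "word (ws[i := x]) = word (take i ws) @ rword x @ word (drop (Suc i) ws)"
    "word ws = word (take i ws) @ rword (ws ! i) @ word (drop (Suc i) ws)"
proof -
  have i: "i < length ws" using assms by (simp add: tuples_def)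
  show "word (ws[i := x]) = word (take i ws) @ rword x @ word (drop (Suc i) ws)"
    using i by (simp add: word_def upd_conv_take_nth_drop)
  show "word ws = word (take i ws) @ rword (ws ! i) @ word (drop (Suc i) ws)"
    using id_take_nth_drop[OF i] by (metis (no_types) word_def concat_append map_append concat.simps(2) list.simps(9))
qed

lemma set_word_parts:
  assumes "ws \<in> tuples" "i < length Ss" "s \<in> set (word (take i ws)) \<union> set (word (drop (Suc i) ws))"
  shows "\<exists>j < length Ss. j \<noteq> i \<and> s \<in> Ss ! j"
proof -
  have len: "length ws = length Ss" using assms by (simp add: tuples_def)
  have set: "\<exists>x \<in> set xs. s \<in> set (rword x)" if "s \<in> set (word xs)" for xs
    using that by (auto simp: word_def)
  from assms(3) have "\<exists>j < length Ss. j \<noteq> i \<and> s \<in> set (rword (ws ! j))"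
  proof
    assume "s \<in> set (word (take i ws))"
    then obtain x where x: "x \<in> set (take i ws)" "s \<in> set (rword x)" using set by blast
    then obtain j where "j < i" "j < length ws" "x = ws ! j" by (auto simp: set_conv_nth[of "take i ws"])
    then show ?thesis using x len by (intro exI[of _ j]) simp
  next
    assume "s \<in> set (word (drop (Suc i) ws))"
    then obtain x where x: "x \<in> set (drop (Suc i) ws)" "s \<in> set (rword x)" using set by blast
    then obtain k where "k < length ws - Suc i" "x = ws ! (Suc i + k)"
      by (auto simp: set_conv_nth[of "drop (Suc i) ws"])
    then show ?thesis using x len by (intro exI[of _ "Suc i + k"]) simp
  qed
  then show ?thesis using tuples_rword(4)[OF assms(1)] by blast
qed

lemma word_parts_lists:
  assumes "ws \<in> tuples" "i < length Ss"
  shows "word (take i ws) \<in> lists S" "word (drop (Suc i) ws) \<in> lists S" "rword (ws ! i) \<in> lists S"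
  using word_lists[OF assms(1)] word_update(2)[OF assms] by auto

lemma index_tuples: "ws \<in> basis_index W S m q Ss \<Longrightarrow> ws \<in> tuples"
  by (simp add: basis_index_eq)

lemma tuples_update:
  assumes "ws \<in> tuples" "i < length Ss" "x \<in> generate W (Ss ! i)"
  shows "ws[i := x] \<in> tuples"
  using assms by (auto simp: tuples_def nth_list_update)

text \<open>Generators of different components commute, so s can be carried past the earlier entries
  to its own slot, where the usual rule for T_s T_w applies.\<close>

lemma hw_Cons_tuple:
  assumes ws: "ws \<in> tuples" and i: "i < length Ss" and s: "s \<in> Ss ! i"
  shows "ws[i := s \<otimes> ws ! i] \<in> tuples"
    "hw (s # word ws) = hw (word (ws[i := s \<otimes> ws ! i])) \<or>
     hw (s # word ws) = ((1 - q s) \<odot>\<^bsub>H\<^esub> hw (word ws)) \<oplus>\<^bsub>H\<^esub> (q s \<odot>\<^bsub>H\<^esub> hw (word (ws[i := s \<otimes> ws ! i])))"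
proof -
  let ?A = "word (take i ws)" and ?B = "word (drop (Suc i) ws)" and ?U = "rword (ws ! i)"
  let ?x = "s \<otimes> ws ! i"
  have sS: "s \<in> S" using s i Ss_subset by blast
  have w: "ws ! i \<in> carrier W" "ws ! i \<in> generate W (Ss ! i)"
    using ws i tuples_rword by (auto simp: tuples_def)
  show "ws[i := ?x] \<in> tuples"
    using tuples_update[OF ws i] generate.eng[OF generate.incl[OF s] w(2)] by blast
  have L: "?A \<in> lists S" "?B \<in> lists S" "?U \<in> lists S" using word_parts_lists[OF ws i] by auto
  have U: "reduced ?U" "ev ?U = ws ! i" using tuples_rword[OF ws i] by auto
  have V: "reduced (rword ?x)" "ev (rword ?x) = ?x" using rword[of ?x] w sS by auto
  have VL: "rword ?x \<in> lists S" using V reduced_lists by blast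
  have "hw [s, t] = hw [t, s]" if t: "t \<in> set ?A" for t
    using set_word_parts[OF ws i, of t] t hw_commute[OF i] s by blast
  then have "hw (s # ?A) = hw (?A @ [s])" using hw_commute_gen[of s ?A] sS L by blast
  then have move: "hw (s # word ws) = hw (?A @ [s] @ ?U @ ?B)"
    unfolding word_update(2)[OF ws i]
    using hw_cong[of "s # ?A" "?A @ [s]" "[]" "?U @ ?B"] sS L by simp
  from len_cases[OF sS w(1)]
  show "hw (s # word ws) = hw (word (ws[i := ?x])) \<or>
     hw (s # word ws) = ((1 - q s) \<odot>\<^bsub>H\<^esub> hw (word ws)) \<oplus>\<^bsub>H\<^esub> (q s \<odot>\<^bsub>H\<^esub> hw (word (ws[i := ?x])))"
  proof
    assume "len ?x = Suc (len (ws ! i))"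
    then have "reduced (s # ?U)" using reduced_Cons[OF U(1) sS] U by simp
    then have "hw (s # ?U) = hw (rword ?x)" by (rule hw_reduced) (simp_all add: V U)
    then have "hw (s # word ws) = hw (word (ws[i := ?x]))"
      unfolding move word_update(1)[OF ws i]
      using hw_cong[of "s # ?U" "rword ?x" ?A ?B] sS L VL by simp
    then show ?thesis ..
  next
    assume l: "len (ws ! i) = Suc (len ?x)"
    then have "reduced (s # rword ?x)" using reduced_Cons[OF V(1) sS] V w sS by simp
    \<comment> \<open>Since s is a descent, the entry may be replaced by a reduced word starting
      with s; this exposes the square for the quadratic relation.\<close>
    then have *: "hw ?U = hw (s # rword ?x)" using hw_reduced[of ?U "s # rword ?x"] V U w sS by simp
    have "hw (s # word ws) = hw (?A @ [s, s] @ (rword ?x @ ?B))"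
      unfolding move using hw_cong[OF *, of "?A @ [s]" ?B] sS L VL by simp
    also have "\<dots> = ((1 - q s) \<odot>\<^bsub>H\<^esub> hw (?A @ [s] @ (rword ?x @ ?B))) \<oplus>\<^bsub>H\<^esub> (q s \<odot>\<^bsub>H\<^esub> hw (?A @ (rword ?x @ ?B)))"
      using sS L VL by (intro hw_quadratic) auto
    also have "hw (?A @ [s] @ (rword ?x @ ?B)) = hw (word ws)"
      unfolding word_update(2)[OF ws i] using hw_cong[OF *, of ?A ?B] sS L VL by simp
    finally show ?thesis using word_update(1)[OF ws i] by simp
  qed
qed

lemma drop_dominated:
  assumes ws: "ws \<in> tuples" and i: "i < length Ss" and j: "j < length Ss"
    and dom: "dominates W S m q Ss i (ws ! i) j"
  shows "hw (word (ws[j := \<one>])) = hw (word ws)"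
proof -
  let ?A = "word (take j ws)" and ?B = "word (drop (Suc j) ws)" and ?U = "rword (ws ! j)"
  from dom obtain s t u where ij: "i \<noteq> j" and s: "s \<in> Ss ! i" "q s = 0" and t: "t \<in> Ss ! j" "m s t = 3"
    and u: "reduced u" "ev u = ws ! i" "s \<in> set u"
    unfolding dominates_def reduced_expression_iff by blast
  have S: "s \<in> S" "t \<in> S" using s t i j Ss_subset by blast+
  \<comment> \<open>Domination speaks of some reduced expression; the common support carries s over
    to the chosen one.\<close>
  have sU: "s \<in> set (rword (ws ! i))"
    using reduced_set[OF u(1), of "rword (ws ! i)"] u tuples_rword[OF ws i] by simp
  have "s \<noteq> t" using Ss_disjoint[OF i j] s t ij by blast
  then have "q s \<noteq> q t" using Ss_edge[OF i s(1) S(2) _ t(2)] Ss_disjoint[OF i j] t ij by blast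
  then have qt: "q t \<noteq> 0" using s by simp
  have absorb: "absorbs s t'" if "t' \<in> set ?U" for t'
    using absorbs_component[OF S(1) s(2) t(2) qt j t(1)] that tuples_rword(4)[OF ws j] by blast
  have L: "?A \<in> lists S" "?B \<in> lists S" "?U \<in> lists S" using word_parts_lists[OF ws j] by auto
  have comm: "hw [r, t'] = hw [t', r]" if "r \<in> set ?A \<union> set ?B" "t' \<in> set ?U" for r t'
    using set_word_parts[OF ws j that(1)] hw_commute[of _ j r t'] j that(2) tuples_rword(4)[OF ws j] by blast
  \<comment> \<open>Because \<open>i \<noteq> j\<close>, the absorbing letter survives when entry j
    is erased, and so lies to one side of it.\<close>
  have "s \<in> set (word (ws[j := \<one>]))"
    using sU ij i ws by (auto simp: word_def tuples_def set_conv_nth[of "ws[j := \<one>]"] nth_list_update intro!: bexI[of _ "ws ! i"] exI[of _ i])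
  then have "s \<in> set ?A \<or> s \<in> set ?B" using word_update(1)[OF ws j, of \<one>] by auto
  then have "hw (?A @ ?U @ ?B) = hw (?A @ ?B)"
  proof
    assume sA: "s \<in> set ?A"
    have "hw (?A @ ?U) = hw ?A" by (rule drop_absorbed(2)[OF sA L(3,1) absorb]) (use comm in blast)+
    then show ?thesis using hw_cong[of "?A @ ?U" ?A "[]" ?B] L by simp
  next
    assume sB: "s \<in> set ?B"
    have "hw (?U @ ?B) = hw ?B" by (rule drop_absorbed(1)[OF sB L(3,2) absorb]) (use comm in blast)+
    then show ?thesis using hw_cong[of "?U @ ?B" ?B ?A "[]"] L by simp
  qed
  then show ?thesis using word_update(1)[OF ws j, of \<one>] word_update(2)[OF ws j] by simp
qed

text \<open>Erasing a dominated entry may undo other dominations but never creates a nontrivial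
  entry, so the number of nontrivial entries decreases.\<close>

lemma reduce_to_index:
  "ws \<in> tuples \<Longrightarrow> \<exists>ws' \<in> basis_index W S m q Ss. hw (word ws') = hw (word ws)"
proof (induction "card {j. j < length Ss \<and> ws ! j \<noteq> \<one>}" arbitrary: ws rule: less_induct)
  case less
  show ?case
  proof (cases "ws \<in> basis_index W S m q Ss")
    case False
    then obtain i j where ij: "i < length Ss" "j < length Ss" "dominates W S m q Ss i (ws ! i) j" "ws ! j \<noteq> \<one>"
      using less.prems unfolding basis_index_eq by blast
    have len: "length ws = length Ss" using less.prems by (simp add: tuples_def)
    have tup: "ws[j := \<one>] \<in> tuples" using tuples_update less.prems ij generate.one by blast
    have "{k. k < length Ss \<and> ws[j := \<one>] ! k \<noteq> \<one>} \<subset> {k. k < length Ss \<and> ws ! k \<noteq> \<one>}"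
      using ij len by (auto simp: nth_list_update split: if_splits)
    then have "card {k. k < length Ss \<and> ws[j := \<one>] ! k \<noteq> \<one>} < card {k. k < length Ss \<and> ws ! k \<noteq> \<one>}"
      by (intro psubset_card_mono) simp_all
    then obtain ws' where "ws' \<in> basis_index W S m q Ss" "hw (word ws') = hw (word (ws[j := \<one>]))"
      using less.hyps tup by blast
    then show ?thesis using drop_dominated[OF less.prems ij(1-3)] by auto
  qed blast
qed

section \<open>Spanning of the whole algebra\<close>

lemma mult_smult:
  assumes "x \<in> carrier H" "y \<in> carrier H"
  shows "y \<otimes>\<^bsub>H\<^esub> (c \<odot>\<^bsub>H\<^esub> x) = c \<odot>\<^bsub>H\<^esub> (y \<otimes>\<^bsub>H\<^esub> x)"
proof -
  obtain p r where p: "p \<in> carrier (free_algebra S)" "x = hecke_class S m q p"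
    and r: "r \<in> carrier (free_algebra S)" "y = hecke_class S m q r"
    using assms unfolding carrier_hecke_algebra by blast
  have "r * (scalar c * p) = scalar c * (r * p)" by (metis mult.assoc scalar_commute)
  then show ?thesis
    unfolding p(2) r(2) hecke_class_smult[OF p(1)] hecke_class_mult[OF r(1) p(1)]
      hecke_class_mult[OF r(1) free_algebra_mult_closed[OF scalar_closed p(1)]]
      hecke_class_smult[OF free_algebra_mult_closed[OF r(1) p(1)]] by simp
qed

lemma spanning: "H.span (basis_element W S m q ` basis_index W S m q Ss) = carrier H"
proof
  let ?B = "basis_element W S m q ` basis_index W S m q Ss"
  have B: "?B = hw ` word ` basis_index W S m q Ss"
    unfolding image_image by (intro image_cong HOL.refl basis_element_word index_tuples)
  have BH: "?B \<subseteq> carrier H"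
    unfolding B by (rule subsetI, clarify, intro hecke_word_closed word_lists index_tuples)
  show "H.span ?B \<subseteq> carrier H" by (rule H.span_is_subset2[OF BH])
  note sub = H.span_is_submodule[OF BH]
  have tuples_span: "hw (word ws) \<in> H.span ?B" if ws: "ws \<in> tuples" for ws
  proof -
    obtain ws' where ws': "ws' \<in> basis_index W S m q Ss" "hw (word ws') = hw (word ws)"
      using reduce_to_index[OF ws] by (elim bexE)
    have "hw (word ws') \<in> ?B" unfolding B by (intro imageI ws'(1))
    then show ?thesis unfolding ws'(2)[symmetric] by (rule subsetD[OF H.in_own_span[OF BH]])
  qed
  have gen: "hw (s # word ws) \<in> H.span ?B" if ws: "ws \<in> tuples" "s \<in> S" for s ws
  proof -
    obtain i where i: "i < length Ss" "s \<in> Ss ! i" using Ss_cover[OF ws(2)] by blast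
    show ?thesis
      using hw_Cons_tuple[OF ws(1) i] tuples_span
        LinearCombinations.submodule.m_closed[OF sub] LinearCombinations.submodule.smult_closed[OF sub] ws(1)
      by (auto simp: class_ring_simps)
  qed
  have left: "hw [s] \<otimes>\<^bsub>H\<^esub> x \<in> H.span ?B" if s: "s \<in> S" and x: "x \<in> H.span ?B" for s x
  proof -
    \<comment> \<open>The elements that left multiplication by T_s sends into the span form a
      submodule. As it contains the spanning family, the span is stable under T_s.\<close>
    let ?N = "{y \<in> carrier H. hw [s] \<otimes>\<^bsub>H\<^esub> y \<in> H.span ?B}"
    have hs: "hw [s] \<in> carrier H" using s by simp
    have "LinearCombinations.submodule class_ring ?N H"
    proof (rule LinearCombinations.submodule.intro)
      show "module class_ring H" ..
    qed (use hs LinearCombinations.submodule.m_closed[OF sub] LinearCombinations.submodule.smult_closed[OF sub]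
          LinearCombinations.submodule.zero_closed[OF sub]
        in \<open>auto simp: H.r_distr mult_smult class_ring_simps\<close>)
    moreover have "?B \<subseteq> ?N"
    proof
      fix b assume "b \<in> ?B"
      then obtain ws where ws: "ws \<in> tuples" "b = hw (word ws)" unfolding B using index_tuples by blast
      have "hw [s] \<otimes>\<^bsub>H\<^esub> b = hw (s # word ws)"
        using hw_append[of "[s]" "word ws"] s word_lists ws by simp
      then show "b \<in> ?N" using gen[OF ws(1) s] ws word_lists by simp
    qed
    ultimately have "H.span ?B \<subseteq> ?N" using H.span_is_subset by blast
    then show ?thesis using x by blast
  qed
  have words: "hw u \<in> H.span ?B" if "u \<in> lists S" for u
    using that
  proof (induction u)
    case Nil
    have "replicate (length Ss) \<one> \<in> tuples" by (simp add: tuples_def generate.one)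
    moreover have "word (replicate (length Ss) \<one>) = []" by (simp add: word_def)
    ultimately show ?case using tuples_span by metis
  next
    case (Cons s u)
    then show ?case using left[of s "hw u"] hw_append[of "[s]" u] by simp
  qed
  show "carrier H \<subseteq> H.span ?B"
  proof
    fix x assume "x \<in> carrier H"
    then obtain p where p: "p \<in> carrier (free_algebra S)" "x = hecke_class S m q p"
      unfolding carrier_hecke_algebra by blast
    let ?s = "\<lambda>F. \<Sum>w\<in>F. Poly_Mapping.single w (Poly_Mapping.lookup p w)"
    \<comment> \<open>Restricting to subsets of the keys of p keeps all letters in S, where words
      are known to lie in the span.\<close>
    have "?s F \<in> carrier (free_algebra S) \<and> hecke_class S m q (?s F) \<in> H.span ?B"
      if "finite F" "F \<subseteq> Poly_Mapping.keys p" for F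
      using that
    proof (induction F rule: finite_induct)
      case empty
      then show ?case
        using LinearCombinations.submodule.zero_closed[OF sub] by (simp add: hecke_class_zero)
    next
      case (insert w F)
      have w: "letters w \<in> lists S" using insert p by simp
      define c where "c = Poly_Mapping.lookup p w"
      have e: "Poly_Mapping.single w c = scalar c * monomial (letters w)"
        by (simp add: scalar_def monomial_def mult_single)
      have cl: "scalar c * monomial (letters w) \<in> carrier (free_algebra S)"
        by (rule free_algebra_mult_closed[OF scalar_closed monomial_closed[OF w]])
      have sp: "hecke_class S m q (scalar c * monomial (letters w)) \<in> H.span ?B"
        unfolding hecke_class_smult[OF monomial_closed[OF w], symmetric]
        by (rule LinearCombinations.submodule.smult_closed[OF sub _ words[OF w]]) (simp add: class_ring_simps)
      have F: "?s F \<in> carrier (free_algebra S)" "hecke_class S m q (?s F) \<in> H.span ?B"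
        using insert by (simp_all del: free_algebra_simps)
      have eq: "?s (insert w F) = scalar c * monomial (letters w) + ?s F"
        using insert.hyps by (simp add: e[unfolded c_def] c_def)
      show ?case
        unfolding eq hecke_class_add[OF cl F(1), symmetric]
        by (intro conjI free_algebra_add_closed[OF cl F(1)]
            LinearCombinations.submodule.m_closed[OF sub sp F(2)])
    qed
    from this[of "Poly_Mapping.keys p"] show "x \<in> H.span ?B"
      using poly_mapping_sum_single[of p] p(2) by simp
  qed
qed

end

theorem theorem4p3:
  fixes W :: "('a, 'b) monoid_scheme"
    and S :: "'a set"
    and m :: "'a \<Rightarrow> 'a \<Rightarrow> enat"
    and q :: "'a \<Rightarrow> 'f::field"
    and Ss :: "'a set list"
  assumes "coxeter_system W S m"
    and "simply_laced S m"
    and "collapse_free S m q"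
    and "distinct Ss" and "set Ss = parameter_components S m q"
  shows "inj_on (basis_element W S m q) (basis_index W S m q Ss) \<and>
    vectorspace.basis class_ring (hecke_algebra S m q)
      (basis_element W S m q ` basis_index W S m q Ss)"
proof -
  interpret hecke_parameters W S m q Ss
    using assms
    by (simp add: hecke_parameters_def simply_laced_coxeter_def simply_laced_coxeter_axioms_def
        hecke_parameters_axioms_def)
  have "basis_element W S m q ` basis_index W S m q Ss \<subseteq> carrier (hecke_algebra S m q)"
    by (rule image_subsetI) (simp only: basis_element_word hecke_word_closed word_lists index_tuples)
  then show ?thesis
    using independence spanning vectorspace.basis_def[OF vectorspace_hecke_algebra] by blast
qed

end
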